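(* Let $n\geq 4$ and let $B\subset\mathbb{R}^{n+1}$ be a symmetric convex body such that all its hyperplane sections $\Gamma\cap B$ ($\Gamma$ a linear hyperplane of $\mathbb{R}^{n+1}$) are affine symmetric bodies of revolution which are all linearly equivalent to each other. Then $B$ is an ellipsoid.
   Context: A symmetric convex body is a compact convex subset of a finite-dimensional real vector space with nonempty interior, invariant under $x\mapsto -x$. A hyperplane is a codimension-one linear subspace; a hyperplane section of a set is its intersection with a hyperplane. Two sets are linearly equivalent if a linear isomorphism between their ambient spaces maps one onto the other. A symmetric convex body $K\subset\mathbb{R}^m$ is a symmetric body of revolution if it admits an axis of revolution: a 1-dimensional linear subspace $L$ such that every section of $K$ by an affine hyperplane $A$ orthogonal to $L$ is a closed Euclidean $(m-1)$-ball in $A$ centered at $A\cap L$ (possibly empty or a point); $L^\perp$ is then the associated hyperplane of revolution. An affine symmetric body of revolution is a convex body linearly equivalent to a symmetric body of revolution; images of an axis and its associated hyperplane of revolution under such an equivalence are called an axis of revolution and associated hyperplane of revolution of it. An ellipsoid is a set affinely equivalent to a closed Euclidean unit ball. *)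

theory Defs
  imports "HOL-Analysis.Analysis"
begin

text \<open>All notions are relative to a linear subspace V of a Euclidean space,
  with the inner product inherited from the ambient space (so V is isometric
  to R^m, m = dim V).\<close>

definition sym_convex_body_in :: "'a::euclidean_space set \<Rightarrow> 'a set \<Rightarrow> bool" where
  "sym_convex_body_in V K \<longleftrightarrow>
     K \<subseteq> V \<and> compact K \<and> convex K \<and>
     (\<exists>x e. 0 < e \<and> ball x e \<inter> V \<subseteq> K) \<and>
     (\<forall>x\<in>K. - x \<in> K)"

text \<open>Axis of revolution: the line spanned by the unit vector u in V. Every
  affine hyperplane of V orthogonal to the axis, i.e. {x in V. x . u = t},
  meets K in a closed ball of that hyperplane centred at t*u (possibly empty
  or a point, i.e. radius < 0 or = 0).\<close>
definition axis_of_revolution_in :: "'a::euclidean_space set \<Rightarrow> 'a set \<Rightarrow> 'a \<Rightarrow> bool" where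
  "axis_of_revolution_in V K u \<longleftrightarrow>
     u \<in> V \<and> norm u = 1 \<and>
     (\<forall>t::real. \<exists>r. K \<inter> {x \<in> V. x \<bullet> u = t} = cball (t *\<^sub>R u) r \<inter> {x \<in> V. x \<bullet> u = t})"

definition sym_body_of_revolution_in :: "'a::euclidean_space set \<Rightarrow> 'a set \<Rightarrow> bool" where
  "sym_body_of_revolution_in V K \<longleftrightarrow>
     sym_convex_body_in V K \<and> (\<exists>u. axis_of_revolution_in V K u)"

definition lin_equiv_in :: "'a::euclidean_space set \<Rightarrow> 'a set \<Rightarrow> 'a set \<Rightarrow> 'a set \<Rightarrow> bool" where
  "lin_equiv_in V1 K1 V2 K2 \<longleftrightarrow>
     (\<exists>f. linear f \<and> inj_on f V1 \<and> f ` V1 = V2 \<and> f ` K1 = K2)"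

definition affine_sym_body_of_revolution_in :: "'a::euclidean_space set \<Rightarrow> 'a set \<Rightarrow> bool" where
  "affine_sym_body_of_revolution_in V K \<longleftrightarrow>
     (\<exists>K'. sym_body_of_revolution_in V K' \<and> lin_equiv_in V K V K')"

definition linear_hyperplane :: "'a::euclidean_space set \<Rightarrow> bool" where
  "linear_hyperplane H \<longleftrightarrow> subspace H \<and> dim H = DIM('a) - 1"

definition is_ellipsoid :: "'a::euclidean_space set \<Rightarrow> bool" where
  "is_ellipsoid E \<longleftrightarrow>
     (\<exists>(f::'a \<Rightarrow> 'a) c. linear f \<and> inj f \<and> E = (\<lambda>x. f x + c) ` cball 0 1)"

end

theory Submission
  imports Defs
begin

text \<open>A section of revolution has the form \<open>{x \<in> H. |S x|\<^sup>2 \<le> \<phi> (\<eta> x)}\<close>, where the linear form \<open>\<eta>\<close>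
  is the height along the axis and \<open>S\<close> kills the axis. By linear equivalence all hyperplane
  sections share one profile \<open>\<phi>\<close>. Suppose \<open>\<phi>\<close> is not that of an ellipsoid and let the axis of \<open>H\<close>
  lie in \<open>H'\<close>. The intersection \<open>W\<close> of \<open>H\<close> and \<open>H'\<close> has dimension at least 3, so its section has a
  unique axis; seen from \<open>H\<close> the profile of that section is \<open>\<phi>\<close>, seen from \<open>H'\<close> it is
  \<open>\<phi> (k t) - a t\<^sup>2\<close>, where \<open>a = 0\<close> only if \<open>W\<close> contains the axis of \<open>H'\<close>. Iterating
  \<open>\<phi> t = \<phi> (k t) - a t\<^sup>2\<close> with \<open>a > 0\<close> would make \<open>\<phi>\<close> quadratic, hence the axes of \<open>H\<close> and
  \<open>H'\<close> coincide. Any two axes lie in a common hyperplane, so all hyperplanes have the same axis,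
  which is absurd. Thus all hyperplane sections are ellipsoids; since any three vectors lie in a
  hyperplane, the squared gauge of the body comes from a bilinear form.\<close>

section \<open>Real profiles\<close>

text \<open>Both conditions describe intervals, with centres \<open>- a\<close>, \<open>- b\<close>
  and half-lengths \<open>sqrt A\<close>, \<open>sqrt C\<close>; each contains the endpoints of the
  other. The bound \<open>0 \<le> A\<close> makes them nonempty.\<close>

lemma interval_centre_radius_unique:
  fixes a b A C :: real
  assumes eq: "\<And>s. (s + a)\<^sup>2 \<le> A \<longleftrightarrow> (s + b)\<^sup>2 \<le> C" and "0 \<le> A"
  shows "a = b" and "A = C"
proof -
  have "0 \<le> C"
    using eq[of "- a"] \<open>0 \<le> A\<close> by (auto intro: order_trans[OF zero_le_power2])
  have abs: "\<bar>s + a\<bar> \<le> sqrt A \<longleftrightarrow> \<bar>s + b\<bar> \<le> sqrt C" for s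
    using eq[of s] by (metis \<open>0 \<le> A\<close> \<open>0 \<le> C\<close> real_sqrt_abs real_sqrt_le_iff)
  have pos: "0 \<le> sqrt A" "0 \<le> sqrt C"
    using \<open>0 \<le> A\<close> \<open>0 \<le> C\<close> by auto
  have "\<bar>sqrt A - a + b\<bar> \<le> sqrt C" "\<bar>- sqrt A - a + b\<bar> \<le> sqrt C"
    using abs[of "sqrt A - a"] abs[of "- sqrt A - a"] pos by auto
  moreover have "\<bar>sqrt C - b + a\<bar> \<le> sqrt A" "\<bar>- sqrt C - b + a\<bar> \<le> sqrt A"
    using abs[of "sqrt C - b"] abs[of "- sqrt C - b"] pos by auto
  ultimately have "a = b" "sqrt A = sqrt C"
    by linarith+
  then show "a = b" "A = C"
    by auto
qed

lemma square_bounds_eq: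
  fixes A C :: real
  assumes "\<And>s. s\<^sup>2 \<le> A \<longleftrightarrow> s\<^sup>2 \<le> C" and "0 \<le> A"
  shows "A = C"
  using interval_centre_radius_unique(2)[of 0 A 0 C] assms by simp

text \<open>The function \<open>1 - \<kappa> * t\<^sup>2\<close> obeys the same recurrence. The
  value at 0 is given, and the recurrence at \<open>i = 0\<close> combined with evenness fixes the
  value at \<open>\<tau>\<close>.\<close>

lemma quadratic_from_second_differences:
  fixes \<phi> :: "real \<Rightarrow> real" and j :: nat
  assumes "\<phi> 0 = 1" and "\<phi> \<tau> = \<phi> (- \<tau>)"
    and "\<And>i. i < j \<Longrightarrow> \<phi> ((real i + 1) * \<tau>) + \<phi> ((real i - 1) * \<tau>) - 2 * \<phi> (real i * \<tau>) = - 2 * \<kappa> * \<tau>\<^sup>2"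
    and "i \<le> j"
  shows "\<phi> (real i * \<tau>) = 1 - \<kappa> * (real i * \<tau>)\<^sup>2"
  using \<open>i \<le> j\<close>
proof (induction i rule: less_induct)
  case (less i)
  consider "i = 0" | "i = 1" | k where "i = Suc (Suc k)"
    by (metis One_nat_def not0_implies_Suc)
  then show ?case
  proof cases
    case 1
    then show ?thesis using assms(1) by simp
  next
    case 2
    then show ?thesis using assms(3)[of 0] assms(1,2) less.prems by simp
  next
    case 3
    have "\<phi> (real k * \<tau>) = 1 - \<kappa> * (real k * \<tau>)\<^sup>2"
      "\<phi> (real (Suc k) * \<tau>) = 1 - \<kappa> * (real (Suc k) * \<tau>)\<^sup>2"
      using less.IH[of k] less.IH[of "Suc k"] less.prems 3 by auto
    moreover have "\<phi> (real i * \<tau>) + \<phi> (real k * \<tau>) - 2 * \<phi> (real (Suc k) * \<tau>) = - 2 * \<kappa> * \<tau>\<^sup>2"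
      using assms(3)[of "Suc k"] less.prems 3 by (simp add: add.commute)
    moreover have "x = d - y + 2 * z" if "x + y - 2 * z = d" for x y z d :: real
      using that by simp
    ultimately have "\<phi> (real i * \<tau>) = - 2 * \<kappa> * \<tau>\<^sup>2 - (1 - \<kappa> * (real k * \<tau>)\<^sup>2)
        + 2 * (1 - \<kappa> * (real (Suc k) * \<tau>)\<^sup>2)"
      by metis
    also have "\<dots> = 1 - \<kappa> * (real i * \<tau>)\<^sup>2"
      using 3 by (simp add: power2_eq_square algebra_simps)
    finally show ?thesis .
  qed
qed

text \<open>Stated through \<open>s\<^sup>2 \<le> \<phi> t\<close> because a negative value of
  \<phi> only signals an empty slice and may differ from
  \<open>1 - \<kappa> * t\<^sup>2\<close>.\<close>

definition elliptic_profile :: "(real \<Rightarrow> real) \<Rightarrow> real \<Rightarrow> bool" where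
  "elliptic_profile \<phi> \<kappa> \<longleftrightarrow> (\<forall>s t. s\<^sup>2 \<le> \<phi> t \<longleftrightarrow> s\<^sup>2 + \<kappa> * t\<^sup>2 \<le> 1)"

text \<open>With \<kappa> solving \<open>\<kappa> = \<kappa> * k\<^sup>2 + a\<close>, the function
  \<open>\<phi> t + \<kappa> * t\<^sup>2\<close> does not change when \<open>t\<close> is replaced
  by \<open>k * t\<close>. As \<open>\<bar>k\<bar> < 1\<close>, iteration drives \<open>t\<close> to
  0, where continuity gives the value 1.\<close>

lemma elliptic_profile_if_self_similar:
  fixes \<phi> :: "real \<Rightarrow> real"
  assumes eq: "\<And>s t. s\<^sup>2 \<le> \<phi> t \<longleftrightarrow> s\<^sup>2 \<le> \<phi> (k * t) - a * t\<^sup>2"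
    and "0 < T" and dom: "\<And>t. 0 \<le> \<phi> t \<longleftrightarrow> \<bar>t\<bar> \<le> T"
    and cont: "isCont \<phi> 0" and "\<phi> 0 = 1" and "0 < a"
  shows "\<exists>\<kappa>. elliptic_profile \<phi> \<kappa>"
proof -
  have step: "\<phi> t = \<phi> (k * t) - a * t\<^sup>2" if "\<bar>t\<bar> \<le> T" for t
    using square_bounds_eq[OF eq] dom that by blast
  have kt: "\<bar>k * t\<bar> \<le> T" if "\<bar>t\<bar> \<le> T" for t
  proof -
    have "0 \<le> \<phi> (k * t)"
      using step[OF that] dom[of t] that \<open>0 < a\<close> by (smt (verit) zero_le_mult_iff zero_le_power2)
    then show ?thesis using dom by blast
  qed
  have "\<bar>k\<bar> \<le> 1"
    using kt[of T] \<open>0 < T\<close> by (simp add: abs_mult)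
  \<comment> \<open>For \<open>\<bar>k\<bar> = 1\<close> two applications lead from \<open>T\<close>
    back to \<open>T\<close>, yet each loses \<open>a * T\<^sup>2\<close>.\<close>
  moreover have "\<bar>k\<bar> \<noteq> 1"
  proof
    assume "\<bar>k\<bar> = 1"
    then have "k * (k * T) = T" "(k * T)\<^sup>2 = T\<^sup>2"
      by (auto simp: abs_if power2_eq_square split: if_splits)
    moreover have "\<phi> T = \<phi> (k * T) - a * T\<^sup>2" "\<phi> (k * T) = \<phi> (k * (k * T)) - a * (k * T)\<^sup>2"
      using step[of T] step[of "k * T"] kt[of T] \<open>0 < T\<close> by simp_all
    ultimately have "\<phi> T = \<phi> T - a * T\<^sup>2 - a * T\<^sup>2"
      by (simp only:)
    then show False using \<open>0 < a\<close> \<open>0 < T\<close> by simp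
  qed
  ultimately have k1: "\<bar>k\<bar> < 1" by simp
  then have k2: "k\<^sup>2 < 1" by (simp add: abs_square_less_1)
  define \<kappa> where "\<kappa> = a / (1 - k\<^sup>2)"
  have \<kappa>: "\<kappa> = \<kappa> * k\<^sup>2 + a"
    using k2 by (simp add: \<kappa>_def field_simps)
  have inv: "\<phi> t + \<kappa> * t\<^sup>2 = \<phi> (k * t) + \<kappa> * (k * t)\<^sup>2" if "\<bar>t\<bar> \<le> T" for t
  proof -
    have "\<kappa> * t\<^sup>2 = \<kappa> * (k * t)\<^sup>2 + a * t\<^sup>2"
      by (subst \<kappa>) (simp add: algebra_simps power_mult_distrib)
    then show ?thesis using step[OF that] by simp
  qed
  have iter: "\<bar>k ^ n * t\<bar> \<le> T \<and> \<phi> t + \<kappa> * t\<^sup>2 = \<phi> (k ^ n * t) + \<kappa> * (k ^ n * t)\<^sup>2" if "\<bar>t\<bar> \<le> T" for t n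
  proof (induction n)
    case 0
    then show ?case using that by simp
  next
    case (Suc n)
    then show ?case using kt[of "k ^ n * t"] inv[of "k ^ n * t"] by (simp add: mult.assoc)
  qed
  have quad: "\<phi> t = 1 - \<kappa> * t\<^sup>2" if "\<bar>t\<bar> \<le> T" for t
  proof -
    have "(\<lambda>n. k ^ n * t) \<longlonglongrightarrow> 0 * t"
      using k1 by (intro tendsto_intros LIMSEQ_power_zero) auto
    then have l: "(\<lambda>n. k ^ n * t) \<longlonglongrightarrow> 0" by simp
    have "(\<lambda>n. \<phi> (k ^ n * t) + \<kappa> * (k ^ n * t)\<^sup>2) \<longlonglongrightarrow> \<phi> 0 + \<kappa> * 0\<^sup>2"
      by (intro tendsto_intros l isCont_tendsto_compose[OF cont])
    moreover have "(\<lambda>n. \<phi> (k ^ n * t) + \<kappa> * (k ^ n * t)\<^sup>2) = (\<lambda>n. \<phi> t + \<kappa> * t\<^sup>2)"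
      using iter[OF that] by auto
    ultimately have "\<phi> t + \<kappa> * t\<^sup>2 = 1"
      using \<open>\<phi> 0 = 1\<close> LIMSEQ_unique tendsto_const by fastforce
    then show ?thesis by simp
  qed
  \<comment> \<open>Otherwise \<phi> would belong to a truncated ellipsoid. In that case some
    \<open>t'\<close> just above \<open>T\<close>, with \<open>k * t'\<close> still in the domain,
    would have a nonempty slice by \<open>eq\<close>.\<close>
  have out: "\<kappa> * t\<^sup>2 > 1" if t: "T < \<bar>t\<bar>" for t
  proof (rule ccontr)
    assume neg: "\<not> \<kappa> * t\<^sup>2 > 1"
    have "0 < \<kappa>" using \<open>0 < a\<close> k2 by (simp add: \<kappa>_def)
    have "\<exists>t'. T < t' \<and> t' < \<bar>t\<bar> \<and> \<bar>k\<bar> * t' \<le> T"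
    proof (cases "k = 0")
      case True
      then show ?thesis using that \<open>0 < T\<close> dense[of T "\<bar>t\<bar>"] by auto
    next
      case False
      then have "T < T / \<bar>k\<bar>" using k1 \<open>0 < T\<close> by (simp add: field_simps)
      then obtain t' where "T < t'" "t' < min \<bar>t\<bar> (T / \<bar>k\<bar>)"
        using dense[of T "min \<bar>t\<bar> (T / \<bar>k\<bar>)"] t by auto
      then show ?thesis using False by (auto simp: field_simps intro!: exI[of _ t'])
    qed
    then obtain t' where t': "T < t'" "t' < \<bar>t\<bar>" "\<bar>k\<bar> * t' \<le> T" by blast
    have "t'\<^sup>2 \<le> t\<^sup>2"
      using t' \<open>0 < T\<close> by (intro abs_le_square_iff[THEN iffD1]) auto
    then have "\<kappa> * t'\<^sup>2 \<le> 1"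
      using neg \<open>0 < \<kappa>\<close> by (smt (verit) mult_left_mono)
    have "\<bar>k * t'\<bar> \<le> T" using t' \<open>0 < T\<close> by (simp add: abs_mult)
    then have "\<phi> (k * t') - a * t'\<^sup>2 = 1 - \<kappa> * (k * t')\<^sup>2 - a * t'\<^sup>2"
      by (simp add: quad)
    also have "\<dots> = 1 - \<kappa> * t'\<^sup>2"
      by (subst (2) \<kappa>) (simp add: algebra_simps power_mult_distrib)
    finally have "0 \<le> \<phi> t'"
      using \<open>\<kappa> * t'\<^sup>2 \<le> 1\<close> eq[of 0 t'] by simp
    then show False using dom[of t'] t' \<open>0 < T\<close> by auto
  qed
  have "s\<^sup>2 \<le> \<phi> t \<longleftrightarrow> s\<^sup>2 + \<kappa> * t\<^sup>2 \<le> 1" for s t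
  proof (cases "\<bar>t\<bar> \<le> T")
    case True
    then show ?thesis by (auto simp: quad)
  next
    case False
    then have "\<phi> t < 0" "\<kappa> * t\<^sup>2 > 1" using dom[of t] out[of t] by auto
    then show ?thesis using zero_le_power2[of s] by linarith
  qed
  then show ?thesis unfolding elliptic_profile_def by blast
qed

section \<open>Symmetric convex bodies\<close>

text \<open>The pair \<open>(f, g)\<close> maps into a plane, so it is not injective on
  \<open>W\<close>. This is the source of the bound 3 on the dimension of sections below.\<close>

lemma common_kernel_vector:
  fixes W :: "'a::euclidean_space set" and f g :: "'a \<Rightarrow> real"
  assumes "subspace W" "3 \<le> dim W" "linear f" "linear g"
  shows "\<exists>x\<in>W. x \<noteq> 0 \<and> f x = 0 \<and> g x = 0"
proof (rule ccontr)
  assume no: "\<not> ?thesis"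
  let ?h = "\<lambda>x. (f x, g x)"
  have lin: "linear ?h"
    using assms(3,4) by (simp add: linear_iff)
  have "inj_on ?h W"
    using no assms(1) lin by (subst linear_injective_on_subspace_0) (auto simp: zero_prod_def)
  then have "dim (?h ` W) = dim W"
    using lin assms(1) by (intro dim_image_eq) (simp_all add: span_eq_iff[THEN iffD2])
  moreover have "dim (?h ` W) \<le> DIM(real \<times> real)"
    by (rule dim_subset_UNIV)
  ultimately show False using assms(2) by simp
qed

text \<open>Three vectors, because additivity of a bilinear form involves three at a time; repeated
  arguments handle fewer.\<close>

definition hyperplane_through :: "'a::euclidean_space \<Rightarrow> 'a \<Rightarrow> 'a \<Rightarrow> 'a set" where
  "hyperplane_through x y z = (SOME H. linear_hyperplane H \<and> x \<in> H \<and> y \<in> H \<and> z \<in> H)"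

lemma hyperplane_through:
  fixes x y z :: "'a::euclidean_space"
  assumes "4 \<le> DIM('a)"
  shows "linear_hyperplane (hyperplane_through x y z)" "x \<in> hyperplane_through x y z"
    "y \<in> hyperplane_through x y z" "z \<in> hyperplane_through x y z"
proof -
  have "dim {x, y, z} \<le> card {x, y, z}" by (intro dim_le_card') auto
  also have "\<dots> < DIM('a)" using card_insert_le_m1[of 3 "{y, z}" x] card_insert_le_m1[of 2 "{z}" y] assms by simp
  finally obtain n where n: "n \<noteq> 0" "\<And>w. w \<in> span {x, y, z} \<Longrightarrow> orthogonal n w"
    using orthogonal_to_subspace_exists[of "{x, y, z}"] by metis
  then have "linear_hyperplane {w. n \<bullet> w = 0}"
    by (simp add: linear_hyperplane_def subspace_hyperplane dim_hyperplane)
  moreover have "n \<bullet> x = 0" "n \<bullet> y = 0" "n \<bullet> z = 0"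
    using n(2) by (auto simp: orthogonal_def span_base)
  ultimately have "\<exists>H. linear_hyperplane H \<and> x \<in> H \<and> y \<in> H \<and> z \<in> H" by blast
  then show "linear_hyperplane (hyperplane_through x y z)" "x \<in> hyperplane_through x y z"
    "y \<in> hyperplane_through x y z" "z \<in> hyperplane_through x y z"
    unfolding hyperplane_through_def by (metis (mono_tags, lifting) someI_ex)+
qed

text \<open>Completing the square in \<open>s\<close>: the chord of a round slice in direction
  \<open>v\<close> is an interval with centre \<open>- (u \<bullet> v)\<close>.\<close>

lemma norm_add_scaleR_unit:
  fixes u v :: "'a::euclidean_space"
  assumes "norm v = 1"
  shows "(norm (u + s *\<^sub>R v))\<^sup>2 = (norm u)\<^sup>2 + (s + u \<bullet> v)\<^sup>2 - (u \<bullet> v)\<^sup>2"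
proof -
  have "v \<bullet> v = 1" using assms by (simp add: norm_eq_1)
  then show ?thesis
    unfolding power2_norm_eq_inner
    by (simp add: inner_add_left inner_add_right inner_commute power2_eq_square algebra_simps)
qed

locale symmetric_body =
  fixes B :: "'a::euclidean_space set"
  assumes compact_B: "compact B" and convex_B: "convex B"
    and minus_mem: "x \<in> B \<Longrightarrow> - x \<in> B"
    and zero_interior: "\<exists>e>0. ball 0 e \<subseteq> B"
begin

lemma scale_mem:
  assumes "x \<in> B" "\<bar>c\<bar> \<le> 1"
  shows "c *\<^sub>R x \<in> B"
proof -
  have "((1 + c) / 2) *\<^sub>R x + ((1 - c) / 2) *\<^sub>R (- x) \<in> B"
    using assms minus_mem by (intro convexD[OF convex_B]) (auto simp: field_simps)
  moreover have "((1 + c) / 2) *\<^sub>R x + ((1 - c) / 2) *\<^sub>R (- x) = c *\<^sub>R x"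
    by (simp add: field_simps flip: scaleR_left_diff_distrib)
  ultimately show ?thesis by simp
qed

lemma minus_mem_iff: "- x \<in> B \<longleftrightarrow> x \<in> B"
  using minus_mem[of x] minus_mem[of "- x"] by auto

lemma absorbing: "\<exists>e>0. \<forall>c. \<bar>c\<bar> \<le> e \<longrightarrow> c *\<^sub>R x \<in> B"
proof -
  obtain e where e: "0 < e" "ball 0 e \<subseteq> B" using zero_interior by blast
  have "c *\<^sub>R x \<in> B" if "\<bar>c\<bar> \<le> e / (norm x + 1)" for c
  proof -
    have "\<bar>c\<bar> * norm x \<le> e / (norm x + 1) * norm x"
      using that by (rule mult_right_mono) simp
    also have "\<dots> < e"
      using e by (simp add: divide_simps add_nonneg_pos)
    finally show ?thesis using e by (auto simp: subset_iff)
  qed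
  moreover have "0 < e / (norm x + 1)" using e by (simp add: add_nonneg_pos)
  ultimately show ?thesis by blast
qed

lemma mem_if_scaled_mem:
  assumes "\<And>r. 0 < r \<Longrightarrow> r < 1 \<Longrightarrow> r *\<^sub>R x \<in> B"
  shows "x \<in> B"
proof -
  \<comment> \<open>The double \<open>Suc\<close> keeps the factors strictly between 0 and 1; the
    first one is 1/2.\<close>
  have "(\<lambda>n. (1 - inverse (real (Suc (Suc n)))) *\<^sub>R x) \<longlonglongrightarrow> (1 - 0) *\<^sub>R x"
    by (intro tendsto_intros LIMSEQ_Suc[OF LIMSEQ_inverse_real_of_nat])
  moreover have "(1 - inverse (real (Suc (Suc n)))) *\<^sub>R x \<in> B" for n
    by (rule assms) (auto simp: field_simps)
  ultimately show ?thesis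
    using compact_imp_closed[OF compact_B] closed_sequentially[of B] by fastforce
qed

lemma line_section:
  assumes "x \<noteq> 0"
  shows "\<exists>T>0. \<forall>t. t *\<^sub>R x \<in> B \<longleftrightarrow> \<bar>t\<bar> \<le> T"
proof -
  let ?A = "{t. t *\<^sub>R x \<in> B}"
  obtain M where M: "\<And>y. y \<in> B \<Longrightarrow> norm y \<le> M"
    using compact_imp_bounded[OF compact_B] bounded_iff by blast
  have "closed ((\<lambda>t. t *\<^sub>R x) -` B)"
    by (intro closed_vimage compact_imp_closed compact_B continuous_intros)
  moreover have "bounded ?A"
    unfolding bounded_iff
  proof (intro exI ballI)
    fix t assume "t \<in> ?A"
    then show "norm t \<le> M / norm x"
      using M[of "t *\<^sub>R x"] assms by (simp add: field_simps)
  qed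
  ultimately have "compact ?A"
    by (simp add: compact_eq_bounded_closed vimage_def)
  moreover obtain e where e: "0 < e" "\<And>c. \<bar>c\<bar> \<le> e \<Longrightarrow> c *\<^sub>R x \<in> B"
    using absorbing by blast
  then have "e \<in> ?A" by simp
  ultimately obtain T where T: "T \<in> ?A" "\<And>t. t \<in> ?A \<Longrightarrow> t \<le> T"
    using compact_attains_sup[of ?A] by blast
  have "0 < T" using T(2)[OF \<open>e \<in> ?A\<close>] e by simp
  moreover have "\<bar>t\<bar> \<le> T" if "t *\<^sub>R x \<in> B" for t
    using T(2)[of t] T(2)[of "- t"] that minus_mem[of "t *\<^sub>R x"] by auto
  moreover have "t *\<^sub>R x \<in> B" if "\<bar>t\<bar> \<le> T" for t
    using scale_mem[of "T *\<^sub>R x" "t / T"] T(1) that \<open>0 < T\<close> by simp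
  ultimately show ?thesis by blast
qed

section \<open>Profiles of sections of revolution\<close>

text \<open>\<open>p\<close> spans the axis, the kernel of \<open>\<eta>\<close> in \<open>V\<close> is the hyperplane of revolution, and
  \<open>\<phi> t\<close> is the squared radius at height \<open>t\<close>, negative when the slice is empty.\<close>

definition revolution_rep :: "'a set \<Rightarrow> ('a \<Rightarrow> real) \<Rightarrow> ('a \<Rightarrow> 'a) \<Rightarrow> 'a \<Rightarrow> (real \<Rightarrow> real) \<Rightarrow> bool" where
  "revolution_rep V \<eta> S p \<phi> \<longleftrightarrow>
     linear \<eta> \<and> linear S \<and> p \<in> V \<and> \<eta> p = 1 \<and> S p = 0 \<and> \<phi> 0 = 1 \<and>
     (\<forall>y\<in>V. \<eta> y = 0 \<longrightarrow> S y = 0 \<longrightarrow> y = 0) \<and>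
     (\<forall>x\<in>V. x \<in> B \<longleftrightarrow> (norm (S x))\<^sup>2 \<le> \<phi> (\<eta> x))"

lemma revolution_repD:
  assumes "revolution_rep V \<eta> S p \<phi>"
  shows "linear \<eta>" "linear S" "p \<in> V" "\<eta> p = 1" "S p = 0" "\<phi> 0 = 1"
    "\<And>y. y \<in> V \<Longrightarrow> \<eta> y = 0 \<Longrightarrow> S y = 0 \<Longrightarrow> y = 0"
    "\<And>x. x \<in> V \<Longrightarrow> x \<in> B \<longleftrightarrow> (norm (S x))\<^sup>2 \<le> \<phi> (\<eta> x)"
  using assms unfolding revolution_rep_def by auto

lemma revolution_rep_nonzero: "revolution_rep V \<eta> S p \<phi> \<Longrightarrow> p \<noteq> 0"
  by (metis linear_0 revolution_repD(1,4) zero_neq_one)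

lemma revolution_rep_subset:
  assumes "revolution_rep V \<eta> S p \<phi>" "W \<subseteq> V" "p \<in> W"
  shows "revolution_rep W \<eta> S p \<phi>"
  using assms unfolding revolution_rep_def by blast

text \<open>Dimension 3 leaves room for one linear condition \<open>f\<close> besides \<eta>.
  Normalising is possible since \<open>S\<close> is injective on the kernel of \<eta> in
  \<open>W\<close>.\<close>

lemma unit_vector_in_common_kernel:
  fixes f :: "'a \<Rightarrow> real"
  assumes "subspace W" "3 \<le> dim W" "linear f" "revolution_rep W \<eta> S p \<phi>"
  obtains e where "e \<in> W" "\<eta> e = 0" "f e = 0" "norm (S e) = 1"
proof -
  note R = revolution_repD[OF assms(4)]
  obtain y where y: "y \<in> W" "y \<noteq> 0" "\<eta> y = 0" "f y = 0"
    using common_kernel_vector[OF assms(1,2) R(1) assms(3)] by blast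
  then have "S y \<noteq> 0" using R(7) by blast
  then show ?thesis
    using y by (intro that[of "(1 / norm (S y)) *\<^sub>R y"])
      (auto simp: subspace_scale[OF assms(1)] linear_scale[OF R(1)] linear_scale[OF R(2)]
        linear_scale[OF assms(3)])
qed

text \<open>The plane of the axis and \<open>e\<close> suffices to recover the profile, since
  \<open>\<bar>s\<bar>\<close> is the distance from the axis measured by \<open>S\<close>.\<close>

lemma slice_mem_iff:
  assumes "subspace W" "revolution_rep W \<eta> S p \<phi>" "e \<in> W" "\<eta> e = 0" "norm (S e) = 1"
  shows "t *\<^sub>R p + s *\<^sub>R e \<in> B \<longleftrightarrow> s\<^sup>2 \<le> \<phi> t"
proof -
  note R = revolution_repD[OF assms(2)]
  have "t *\<^sub>R p + s *\<^sub>R e \<in> W"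
    using assms R(3) by (intro subspace_add subspace_scale)
  then show ?thesis
    using R(8)[of "t *\<^sub>R p + s *\<^sub>R e"] R(4,5) assms(4,5)
    by (simp add: linear_add[OF R(1)] linear_add[OF R(2)] linear_scale[OF R(1)] linear_scale[OF R(2)])
qed

lemma profile_domain:
  assumes "subspace W" "revolution_rep W \<eta> S p \<phi>"
  shows "0 \<le> \<phi> t \<longleftrightarrow> t *\<^sub>R p \<in> B"
proof -
  note R = revolution_repD[OF assms(2)]
  have "t *\<^sub>R p \<in> W" using assms R(3) by (intro subspace_scale)
  then show ?thesis
    using R(8)[of "t *\<^sub>R p"] R(4,5) by (simp add: linear_scale[OF R(1)] linear_scale[OF R(2)])
qed

text \<open>Reflection in the origin exchanges the slices at heights \<open>t\<close> and
  \<open>- t\<close>. Only nonempty slices determine \<phi>, hence the restriction to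
  \<open>0 \<le> \<phi> t\<close>.\<close>

lemma profile_even:
  assumes "subspace W" "3 \<le> dim W" "revolution_rep W \<eta> S p \<phi>" "0 \<le> \<phi> t"
  shows "\<phi> (- t) = \<phi> t"
proof -
  obtain e where e: "e \<in> W" "\<eta> e = 0" "norm (S e) = 1"
    using unit_vector_in_common_kernel[OF assms(1,2) revolution_repD(1)[OF assms(3)] assms(3)] by metis
  note mem = slice_mem_iff[OF assms(1,3) e]
  have "s\<^sup>2 \<le> \<phi> t \<longleftrightarrow> s\<^sup>2 \<le> \<phi> (- t)" for s
    using minus_mem_iff[of "t *\<^sub>R p + s *\<^sub>R e"] mem[of t s] mem[of "- t" "- s"] by simp
  from square_bounds_eq[OF this \<open>0 \<le> \<phi> t\<close>] show ?thesis by simp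
qed

lemma profile_isCont_0:
  assumes "subspace W" "3 \<le> dim W" "revolution_rep W \<eta> S p \<phi>"
  shows "isCont \<phi> 0"
proof -
  note R = revolution_repD[OF assms(3)]
  obtain e where e: "e \<in> W" "\<eta> e = 0" "norm (S e) = 1"
    using unit_vector_in_common_kernel[OF assms(1,2) R(1) assms(3)] by metis
  note mem = slice_mem_iff[OF assms(1,3) e]
  obtain T where T: "0 < T" "\<And>t. t *\<^sub>R p \<in> B \<longleftrightarrow> \<bar>t\<bar> \<le> T"
    using line_section[OF revolution_rep_nonzero[OF assms(3)]] by blast
  \<comment> \<open>The point at height \<open>t\<close> with radius
    \<open>1 - \<bar>t\<bar> / T\<close> lies on the segment from \<open>e\<close> to the end of the
    axis on the side of \<open>t\<close>.\<close>
  have lower: "(1 - \<bar>t\<bar> / T)\<^sup>2 \<le> \<phi> t" if "\<bar>t\<bar> < T" for t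
  proof (cases "t = 0")
    case False
    have "((\<bar>t\<bar> / T) *\<^sub>R (t * T / \<bar>t\<bar>) *\<^sub>R p + (1 - \<bar>t\<bar> / T) *\<^sub>R e) \<in> B"
    proof (rule convexD[OF convex_B])
      show "(t * T / \<bar>t\<bar>) *\<^sub>R p \<in> B" using T False by (simp add: abs_mult)
      show "e \<in> B" using mem[of 0 1] R(6) by simp
    qed (use that T in auto)
    moreover have "(\<bar>t\<bar> / T) * (t * T / \<bar>t\<bar>) = t" using T False by simp
    ultimately show ?thesis using mem[of t] by simp
  qed (use R(6) in simp)
  \<comment> \<open>A point at height \<open>t\<close> and its mirror image at height
    \<open>- t\<close> have their midpoint in the central slice, whose radius is 1.\<close>
  have upper: "\<phi> t \<le> 1" if "\<bar>t\<bar> < T" for t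
  proof -
    have "0 \<le> \<phi> t" using profile_domain[OF assms(1,3)] T(2) that by simp
    let ?s = "sqrt (\<phi> t)"
    have "t *\<^sub>R p + ?s *\<^sub>R e \<in> B" "(- t) *\<^sub>R p + ?s *\<^sub>R e \<in> B"
      using mem[of t ?s] mem[of "- t" ?s] profile_even[OF assms \<open>0 \<le> \<phi> t\<close>] \<open>0 \<le> \<phi> t\<close> by auto
    then have "(1/2) *\<^sub>R (t *\<^sub>R p + ?s *\<^sub>R e) + (1/2) *\<^sub>R ((- t) *\<^sub>R p + ?s *\<^sub>R e) \<in> B"
      by (rule convexD[OF convex_B]) auto
    moreover have "(1/2) *\<^sub>R (t *\<^sub>R p + ?s *\<^sub>R e) + (1/2) *\<^sub>R ((- t) *\<^sub>R p + ?s *\<^sub>R e) = 0 *\<^sub>R p + ?s *\<^sub>R e"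
      using scaleR_half_double[of "?s *\<^sub>R e"]
      by (simp add: scaleR_add_right scaleR_diff_right)
    ultimately have "?s\<^sup>2 \<le> \<phi> 0" using mem[of 0 ?s] by simp
    then show ?thesis using \<open>0 \<le> \<phi> t\<close> R(6) by simp
  qed
  have near: "eventually (\<lambda>t. \<bar>t\<bar> < T) (at 0)"
    unfolding eventually_at using T(1) by (auto intro: exI[of _ T])
  have "((\<lambda>t. (1 - \<bar>t\<bar> / T)\<^sup>2) \<longlongrightarrow> (1 - \<bar>0\<bar> / T)\<^sup>2) (at 0)"
    using T(1) by (intro tendsto_intros) auto
  then have "(\<phi> \<longlongrightarrow> 1) (at 0)"
    by (intro tendsto_sandwich[of "\<lambda>t. (1 - \<bar>t\<bar> / T)\<^sup>2" \<phi> "at 0" "\<lambda>_. 1"]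
        eventually_mono[OF near]) (auto intro: lower upper)
  then show ?thesis using R(6) by (simp add: isCont_def)
qed

text \<open>Both heights vanish on the line through \<open>e\<close>, and
  \<open>\<phi> 0 = \<phi>' 0 = 1\<close>. So both norms are the gauge of \<open>B\<close> on this
  line.\<close>

lemma reps_agree_on_common_kernel:
  assumes "subspace W" "revolution_rep W \<eta> S p \<phi>" "revolution_rep W \<eta>' S' p' \<phi>'"
    and e: "e \<in> W" "\<eta> e = 0" "\<eta>' e = 0"
  shows "norm (S e) = norm (S' e)"
proof (cases "e = 0")
  case False
  note R = revolution_repD[OF assms(2)] and R' = revolution_repD[OF assms(3)]
  have pos: "0 < norm (S e)" "0 < norm (S' e)"
    using R(7) R'(7) e False by auto
  have "(s * norm (S e))\<^sup>2 \<le> 1 \<longleftrightarrow> (s * norm (S' e))\<^sup>2 \<le> 1" for s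
    using R(8)[of "s *\<^sub>R e"] R'(8)[of "s *\<^sub>R e"] subspace_scale[OF assms(1) e(1)] e R(6) R'(6)
    by (simp add: linear_scale[OF R(1)] linear_scale[OF R(2)] linear_scale[OF R'(1)]
        linear_scale[OF R'(2)] power_mult_distrib)
  from this[of "1 / norm (S e)"] this[of "1 / norm (S' e)"] show ?thesis
    using pos by (simp add: power_le_one_iff)
qed (simp add: linear_0[OF revolution_repD(2)[OF assms(2)]] linear_0[OF revolution_repD(2)[OF assms(3)]])

text \<open>The chord of the body through \<open>x\<close> in a direction \<open>e\<close> lying in both hyperplanes of revolution
  has a centre and a length that can be read off from either representation.\<close>

lemma chord_through_common_kernel:
  assumes W: "subspace W" and reps: "revolution_rep W \<eta> S p \<phi>" "revolution_rep W \<eta>' S' p' \<phi>'"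
    and e: "e \<in> W" "\<eta> e = 0" "\<eta>' e = 0" "norm (S e) = 1" and x: "x \<in> W" "x \<in> B"
  shows "S x \<bullet> S e = S' x \<bullet> S' e"
    and "\<phi> (\<eta> x) - (norm (S x))\<^sup>2 = \<phi>' (\<eta>' x) - (norm (S' x))\<^sup>2"
proof -
  note R = revolution_repD[OF reps(1)] and R' = revolution_repD[OF reps(2)]
  have e': "norm (S' e) = 1"
    using reps_agree_on_common_kernel[OF W reps e(1-3)] e(4) by simp
  define A where "A = \<phi> (\<eta> x) - (norm (S x))\<^sup>2 + (S x \<bullet> S e)\<^sup>2"
  define A' where "A' = \<phi>' (\<eta>' x) - (norm (S' x))\<^sup>2 + (S' x \<bullet> S' e)\<^sup>2"
  have "(s + S x \<bullet> S e)\<^sup>2 \<le> A \<longleftrightarrow> (s + S' x \<bullet> S' e)\<^sup>2 \<le> A'" for s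
  proof -
    have mem: "x + s *\<^sub>R e \<in> W" using W x e by (intro subspace_add subspace_scale)
    show ?thesis
      using R(8)[OF mem] R'(8)[OF mem] e(2,3) norm_add_scaleR_unit[OF e(4)] norm_add_scaleR_unit[OF e']
      by (auto simp: A_def A'_def linear_add[OF R(1)] linear_add[OF R(2)] linear_scale[OF R(1)]
          linear_scale[OF R(2)] linear_add[OF R'(1)] linear_add[OF R'(2)] linear_scale[OF R'(1)]
          linear_scale[OF R'(2)])
  qed
  moreover have "0 \<le> A" using R(8)[OF x(1)] x(2) by (simp add: A_def)
  ultimately have "S x \<bullet> S e = S' x \<bullet> S' e" "A = A'"
    using interval_centre_radius_unique[of "S x \<bullet> S e" A "S' x \<bullet> S' e" A'] by blast+
  then show "S x \<bullet> S e = S' x \<bullet> S' e"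
    "\<phi> (\<eta> x) - (norm (S x))\<^sup>2 = \<phi>' (\<eta>' x) - (norm (S' x))\<^sup>2"
    by (auto simp: A_def A'_def)
qed

text \<open>The excess is the squared half-length minus the squared centre of the chord through
  \<open>x\<close> in a direction common to both hyperplanes of revolution; dimension 3 provides
  such a direction.\<close>

lemma reps_excess_eq:
  assumes "subspace W" "3 \<le> dim W" "revolution_rep W \<eta> S p \<phi>" "revolution_rep W \<eta>' S' p' \<phi>'"
    and "x \<in> W" "x \<in> B"
  shows "\<phi> (\<eta> x) - (norm (S x))\<^sup>2 = \<phi>' (\<eta>' x) - (norm (S' x))\<^sup>2"
proof -
  obtain e where "e \<in> W" "\<eta> e = 0" "\<eta>' e = 0" "norm (S e) = 1"
    using unit_vector_in_common_kernel[OF assms(1,2) revolution_repD(1)[OF assms(4)] assms(3)] by metis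
  then show ?thesis
    using chord_through_common_kernel(2)[OF assms(1,3,4) _ _ _ _ assms(5,6)] by blast
qed

text \<open>The component \<open>e\<close> of \<open>p'\<close> in the first hyperplane of
  revolution lies in the second one as well, by \<open>ker\<close>. Chords in direction
  \<open>e\<close> through points of the second axis are centred on it, since
  \<open>S' p' = 0\<close>; in the first representation their centre is offset by
  \<open>S e\<close>. Hence \<open>e = 0\<close>.\<close>

lemma axes_parallel_if_kernels_eq:
  assumes W: "subspace W" and reps: "revolution_rep W \<eta> S p \<phi>" "revolution_rep W \<eta>' S' p' \<phi>'"
    and ker: "\<And>x. x \<in> W \<Longrightarrow> \<eta> x = 0 \<Longrightarrow> \<eta>' x = 0"
  shows "p' = \<eta> p' *\<^sub>R p"
proof -
  note R = revolution_repD[OF reps(1)] and R' = revolution_repD[OF reps(2)]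
  define e where "e = p' - \<eta> p' *\<^sub>R p"
  have e: "e \<in> W" "\<eta> e = 0" "S e = S p'"
    using R(3,4,5) R'(3) W
    by (auto simp: e_def subspace_diff subspace_scale linear_diff[OF R(1)] linear_scale[OF R(1)]
        linear_diff[OF R(2)] linear_scale[OF R(2)])
  have "e = 0"
  proof (rule ccontr)
    assume "e \<noteq> 0"
    then have ne: "S e \<noteq> 0" using R(7) e by blast
    define u where "u = (1 / norm (S e)) *\<^sub>R e"
    have u: "u \<in> W" "\<eta> u = 0" "\<eta>' u = 0" "norm (S u) = 1"
      using e ker ne W
      by (auto simp: u_def subspace_scale linear_scale[OF R(1)] linear_scale[OF R(2)] linear_scale[OF R'(1)])
    obtain c where c: "0 < c" "c *\<^sub>R p' \<in> B"
      using absorbing[of p'] by (metis abs_of_pos order_refl)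
    have "S (c *\<^sub>R p') \<bullet> S u = S' (c *\<^sub>R p') \<bullet> S' u"
      using chord_through_common_kernel(1)[OF W reps u] c subspace_scale[OF W R'(3)] by blast
    then have "c * (S e \<bullet> S e) = 0"
      using c ne R'(5) e(3)
      by (simp add: u_def linear_scale[OF R(2)] linear_scale[OF R'(2)])
    then show False using c ne by simp
  qed
  then show ?thesis by (simp add: e_def)
qed

section \<open>Uniqueness of the axis\<close>

text \<open>Moving along \<open>w\<close>, which lies in one hyperplane of revolution but not in the other, turns
  the equality of chord lengths into a second order difference equation for \<open>\<phi>\<close>.\<close>

lemma profile_quadratic_inside:
  assumes W: "subspace W" "3 \<le> dim W"
    and reps: "revolution_rep W \<eta> S p \<phi>" "revolution_rep W \<eta>' S' p' \<phi>'"
    and w: "w \<in> W" "\<eta>' w = 0" "\<eta> w = 1"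
    and T: "0 < T" "\<And>t. t *\<^sub>R p \<in> B \<longleftrightarrow> \<bar>t\<bar> \<le> T"
  shows "\<exists>\<kappa>. \<forall>t. \<bar>t\<bar> < T \<longrightarrow> \<phi> t = 1 - \<kappa> * t\<^sup>2"
proof -
  note R = revolution_repD[OF reps(1)] and R' = revolution_repD[OF reps(2)]
  \<comment> \<open>Moving along \<open>w\<close> keeps the height \<open>\<eta>'\<close> fixed. The
    parallelogram law for \<open>S'\<close>, corrected by the growth of \<open>S\<close>, then makes
    the second difference of \<phi> equal to \<open>- 2 * \<kappa> * \<tau>\<^sup>2\<close>.\<close>
  define \<kappa> where "\<kappa> = (norm (S' w))\<^sup>2 - (norm (S w))\<^sup>2"
  have excess: "\<phi> (\<eta> x) - (norm (S x))\<^sup>2 = \<phi>' (\<eta>' x) - (norm (S' x))\<^sup>2" if "x \<in> W" "x \<in> B" for x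
    by (rule reps_excess_eq[OF W reps that])
  have diff: "\<phi> (r + \<tau>) + \<phi> (r - \<tau>) - 2 * \<phi> r = - 2 * \<kappa> * \<tau>\<^sup>2"
    if mem: "r *\<^sub>R p \<in> B" "r *\<^sub>R p + \<tau> *\<^sub>R w \<in> B" "r *\<^sub>R p - \<tau> *\<^sub>R w \<in> B" for r \<tau>
  proof -
    have inW: "r *\<^sub>R p \<in> W" "\<tau> *\<^sub>R w \<in> W"
      using W R(3) w by (auto intro: subspace_scale)
    then have inW': "r *\<^sub>R p + \<tau> *\<^sub>R w \<in> W" "r *\<^sub>R p - \<tau> *\<^sub>R w \<in> W"
      using W by (auto intro: subspace_add subspace_diff)
    note lin = linear_add[OF R(1)] linear_add[OF R(2)] linear_scale[OF R(1)] linear_scale[OF R(2)]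
      linear_diff[OF R(1)] linear_diff[OF R(2)] linear_add[OF R'(1)] linear_add[OF R'(2)]
      linear_scale[OF R'(1)] linear_scale[OF R'(2)] linear_diff[OF R'(1)] linear_diff[OF R'(2)]
    let ?u = "r *\<^sub>R S' p" and ?v = "\<tau> *\<^sub>R S' w"
    have e0: "\<phi> r = \<phi>' (r * \<eta>' p) - (norm ?u)\<^sup>2"
      using excess[OF inW(1) mem(1)] R(4,5) by (simp add: lin)
    have e1: "\<phi> (r + \<tau>) - (norm (\<tau> *\<^sub>R S w))\<^sup>2 = \<phi>' (r * \<eta>' p) - (norm (?u + ?v))\<^sup>2"
      using excess[OF inW'(1) mem(2)] R(4,5) w by (simp add: lin)
    have e2: "\<phi> (r - \<tau>) - (norm (\<tau> *\<^sub>R S w))\<^sup>2 = \<phi>' (r * \<eta>' p) - (norm (?u - ?v))\<^sup>2"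
      using excess[OF inW'(2) mem(3)] R(4,5) w by (simp add: lin)
    have par: "(norm (?u + ?v))\<^sup>2 + (norm (?u - ?v))\<^sup>2 = 2 * (norm ?u)\<^sup>2 + 2 * (norm ?v)\<^sup>2"
      unfolding power2_norm_eq_inner by (simp add: inner_add_left inner_add_right inner_diff_left inner_diff_right algebra_simps)
    have "\<phi> (r + \<tau>) + \<phi> (r - \<tau>) - 2 * \<phi> r = 2 * (norm (\<tau> *\<^sub>R S w))\<^sup>2 - 2 * (norm ?v)\<^sup>2"
      using e0 e1 e2 par by linarith
    also have "\<dots> = - 2 * \<kappa> * \<tau>\<^sup>2"
      by (simp add: \<kappa>_def power_mult_distrib algebra_simps)
    finally show ?thesis .
  qed
  have "\<phi> t = 1 - \<kappa> * t\<^sup>2" if t: "\<bar>t\<bar> < T" for t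
  proof (cases "t = 0")
    case True
    then show ?thesis using R(6) by simp
  next
    case False
    \<comment> \<open>Weights of a convex combination: \<theta> times a point of the axis in
      \<open>B\<close> reaches all heights up to \<open>\<bar>t\<bar>\<close>, and the share
      \<open>1 - \<theta>\<close> is left for moving along \<open>w\<close>. It is positive because
      \<open>\<bar>t\<bar> < T\<close>.\<close>
    define \<theta> where "\<theta> = \<bar>t\<bar> / T"
    have \<theta>: "0 < \<theta>" "\<theta> < 1" using False t T(1) by (auto simp: \<theta>_def)
    obtain \<epsilon> where \<epsilon>: "0 < \<epsilon>" "\<And>c. \<bar>c\<bar> \<le> \<epsilon> \<Longrightarrow> c *\<^sub>R w \<in> B"
      using absorbing[of w] by blast
    \<comment> \<open>So many subdivisions that one step \<open>t / j\<close> along \<open>w\<close>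
      fits into that share.\<close>
    obtain j :: nat where j: "\<bar>t\<bar> / (\<epsilon> * (1 - \<theta>)) < real j"
      using reals_Archimedean2 by blast
    have "0 < \<epsilon> * (1 - \<theta>)" using \<epsilon>(1) \<theta> by simp
    then have jt: "\<bar>t\<bar> < real j * (\<epsilon> * (1 - \<theta>))"
      using j by (simp add: divide_less_eq)
    then have j0: "0 < real j"
      using False by (cases "j = 0") auto
    define \<tau> where "\<tau> = t / real j"
    have "\<bar>\<tau>\<bar> \<le> \<epsilon> * (1 - \<theta>)"
      using jt j0 by (simp add: \<tau>_def field_simps)
    then have \<tau>: "\<bar>\<tau> / (1 - \<theta>)\<bar> \<le> \<epsilon>" "\<bar>- \<tau> / (1 - \<theta>)\<bar> \<le> \<epsilon>"
      using \<theta> by (auto simp: field_simps)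
    have mem: "(real i * \<tau>) *\<^sub>R p + c *\<^sub>R w \<in> B" if "i \<le> j" "\<bar>c / (1 - \<theta>)\<bar> \<le> \<epsilon>" for i c
    proof -
      have "\<bar>real i * \<tau>\<bar> \<le> \<bar>t\<bar>"
        using that(1) j0 by (simp add: \<tau>_def abs_mult field_simps mult_left_mono)
      then have "\<bar>real i * \<tau> / \<theta>\<bar> \<le> T"
        using \<theta> T(1) False by (simp add: \<theta>_def abs_mult field_simps)
      then have "(real i * \<tau> / \<theta>) *\<^sub>R p \<in> B" using T(2) by blast
      then have "\<theta> *\<^sub>R (real i * \<tau> / \<theta>) *\<^sub>R p + (1 - \<theta>) *\<^sub>R (c / (1 - \<theta>)) *\<^sub>R w \<in> B"
        using \<epsilon>(2)[OF that(2)] \<theta> by (intro convexD[OF convex_B]) auto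
      then show ?thesis using \<theta> by simp
    qed
    have "\<phi> ((real i + 1) * \<tau>) + \<phi> ((real i - 1) * \<tau>) - 2 * \<phi> (real i * \<tau>) = - 2 * \<kappa> * \<tau>\<^sup>2"
      if "i < j" for i
      using diff[of "real i * \<tau>" \<tau>] mem[of i 0] mem[of i \<tau>] mem[of i "- \<tau>"] that \<tau> \<epsilon>(1)
      by (simp add: algebra_simps)
    moreover have "\<phi> \<tau> = \<phi> (- \<tau>)"
    proof -
      have "\<tau> *\<^sub>R p \<in> B" using mem[of 1 0] j0 \<epsilon>(1) by simp
      then show ?thesis
        using profile_even[OF W reps(1)] profile_domain[OF W(1) reps(1)] by metis
    qed
    ultimately have "\<phi> (real j * \<tau>) = 1 - \<kappa> * (real j * \<tau>)\<^sup>2"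
      using quadratic_from_second_differences[of \<phi> \<tau> j \<kappa> j] R(6) by blast
    then show ?thesis using j0 by (simp add: \<tau>_def)
  qed
  then show ?thesis by blast
qed

text \<open>Both profiles are quadratic inside their domains. So on \<open>W\<close> the body is the
  set \<open>q \<le> 1\<close>, possibly truncated at \<open>\<bar>\<eta> x\<bar> = T\<close>, and
  also the set \<open>q' \<le> 1\<close>, possibly truncated at
  \<open>\<bar>\<eta>' x\<bar> = T'\<close>. By homogeneity \<open>q = q'\<close>, and truncations
  along two independent forms cannot agree.\<close>

lemma elliptic_if_kernels_neq:
  assumes W: "subspace W" "3 \<le> dim W"
    and reps: "revolution_rep W \<eta> S p \<phi>" "revolution_rep W \<eta>' S' p' \<phi>'"
    and w: "w \<in> W" "\<eta>' w = 0" "\<eta> w = 1" and d: "d \<in> W" "\<eta> d = 0" "\<eta>' d = 1"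
  shows "\<exists>\<kappa>. elliptic_profile \<phi> \<kappa>"
proof -
  note R = revolution_repD[OF reps(1)] and R' = revolution_repD[OF reps(2)]
  obtain T where T: "0 < T" "\<And>t. t *\<^sub>R p \<in> B \<longleftrightarrow> \<bar>t\<bar> \<le> T"
    using line_section[OF revolution_rep_nonzero[OF reps(1)]] by blast
  obtain T' where T': "0 < T'" "\<And>t. t *\<^sub>R p' \<in> B \<longleftrightarrow> \<bar>t\<bar> \<le> T'"
    using line_section[OF revolution_rep_nonzero[OF reps(2)]] by blast
  obtain \<kappa> where \<kappa>: "\<And>t. \<bar>t\<bar> < T \<Longrightarrow> \<phi> t = 1 - \<kappa> * t\<^sup>2"
    using profile_quadratic_inside[OF W reps w T] by blast
  obtain \<kappa>' where \<kappa>': "\<And>t. \<bar>t\<bar> < T' \<Longrightarrow> \<phi>' t = 1 - \<kappa>' * t\<^sup>2"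
    using profile_quadratic_inside[OF W reps(2,1) d T'] by blast
  define q where "q x = (norm (S x))\<^sup>2 + \<kappa> * (\<eta> x)\<^sup>2" for x
  define q' where "q' x = (norm (S' x))\<^sup>2 + \<kappa>' * (\<eta>' x)\<^sup>2" for x
  have q_scale: "q (c *\<^sub>R x) = c\<^sup>2 * q x" for c x
    by (simp add: q_def linear_scale[OF R(1)] linear_scale[OF R(2)] power_mult_distrib algebra_simps)
  have q'_scale: "q' (c *\<^sub>R x) = c\<^sup>2 * q' x" for c x
    by (simp add: q'_def linear_scale[OF R'(1)] linear_scale[OF R'(2)] power_mult_distrib algebra_simps)
  have scaleW: "c *\<^sub>R x \<in> W" if "x \<in> W" for c x
    using W(1) that by (rule subspace_scale)
  have in1: "x \<in> B \<longleftrightarrow> q x \<le> 1" if "x \<in> W" "\<bar>\<eta> x\<bar> < T" for x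
    using R(8)[OF that(1)] \<kappa>[OF that(2)] by (auto simp: q_def)
  have in2: "x \<in> B \<longleftrightarrow> q' x \<le> 1" if "x \<in> W" "\<bar>\<eta>' x\<bar> < T'" for x
    using R'(8)[OF that(1)] \<kappa>'[OF that(2)] by (auto simp: q'_def)
  have height: "\<bar>\<eta> x\<bar> \<le> T" "\<bar>\<eta>' x\<bar> \<le> T'" if "x \<in> W" "x \<in> B" for x
  proof -
    have "0 \<le> \<phi> (\<eta> x)" "0 \<le> \<phi>' (\<eta>' x)"
      using R(8)[OF that(1)] R'(8)[OF that(1)] that(2) by (meson order_trans zero_le_power2)+
    then show "\<bar>\<eta> x\<bar> \<le> T" "\<bar>\<eta>' x\<bar> \<le> T'"
      using profile_domain[OF W(1) reps(1)] profile_domain[OF W(1) reps(2)] T(2) T'(2) by blast+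
  qed
  have qq': "q x = q' x" if x: "x \<in> W" for x
  proof -
    obtain c where c: "0 < c" "c *\<^sub>R x \<in> B"
      using absorbing[of x] by (metis abs_of_pos order_refl)
    define y where "y = (1 / 2) *\<^sub>R c *\<^sub>R x"
    have y: "y \<in> W" "y \<in> B"
      using scaleW x scale_mem[OF c(2), of "1/2"] by (auto simp: y_def)
    have "\<bar>\<eta> y\<bar> < T" "\<bar>\<eta>' y\<bar> < T'"
      using height[OF scaleW[OF x] c(2)] T(1) T'(1)
      unfolding y_def linear_scale[OF R(1), of "1/2"] linear_scale[OF R'(1), of "1/2"] by auto
    then have "q y = q' y"
      using reps_excess_eq[OF W reps y] \<kappa> \<kappa>' by (simp add: q_def q'_def)
    then show ?thesis
      using c by (simp add: y_def q_scale q'_scale)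
  qed
  \<comment> \<open>When \<open>x\<close> is scaled by \<open>r < 1\<close>, it enters
    \<open>B\<close> as soon as \<open>r * \<bar>\<eta> x\<bar> < T\<close>, and likewise as soon as
    \<open>r * \<bar>\<eta>' x\<bar> < T'\<close>. The two thresholds for \<open>r\<close> must
    coincide.\<close>
  have ratio: "\<bar>\<eta>' x\<bar> * T = \<bar>\<eta> x\<bar> * T'" if x: "x \<in> W" "q x \<le> 1" "x \<notin> B" for x
  proof -
    have big: "T \<le> \<bar>\<eta> x\<bar>" "T' \<le> \<bar>\<eta>' x\<bar>"
      using in1[OF x(1)] in2[OF x(1)] qq'[OF x(1)] x(2,3) by (auto simp flip: not_less)
    have q1: "q (r *\<^sub>R x) \<le> 1" if "0 < r" "r < 1" for r
    proof (cases "q x \<le> 0")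
      case True
      then show ?thesis using mult_nonneg_nonpos[of "r\<^sup>2" "q x"] by (simp add: q_scale)
    next
      case False
      then show ?thesis
        using x(2) that mult_le_one[of "r\<^sup>2" "q x"] by (simp add: q_scale power_le_one)
    qed
    have no: "\<not> (T' / \<bar>\<eta>' x\<bar> < r \<and> r < T / \<bar>\<eta> x\<bar>)" "\<not> (T / \<bar>\<eta> x\<bar> < r \<and> r < T' / \<bar>\<eta>' x\<bar>)" for r
    proof -
      have pos: "0 < \<bar>\<eta> x\<bar>" "0 < \<bar>\<eta>' x\<bar>" using big T(1) T'(1) by linarith+
      have le1: "T / \<bar>\<eta> x\<bar> \<le> 1" "T' / \<bar>\<eta>' x\<bar> \<le> 1" "0 < T / \<bar>\<eta> x\<bar>" "0 < T' / \<bar>\<eta>' x\<bar>"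
        using big T(1) T'(1) pos by auto
      have abs: "\<bar>\<eta> (r *\<^sub>R x)\<bar> = r * \<bar>\<eta> x\<bar>" "\<bar>\<eta>' (r *\<^sub>R x)\<bar> = r * \<bar>\<eta>' x\<bar>" if "0 < r"
        using that by (simp_all add: linear_scale[OF R(1)] linear_scale[OF R'(1)] abs_mult)
      show "\<not> (T' / \<bar>\<eta>' x\<bar> < r \<and> r < T / \<bar>\<eta> x\<bar>)"
      proof
        assume r: "T' / \<bar>\<eta>' x\<bar> < r \<and> r < T / \<bar>\<eta> x\<bar>"
        then have r01: "0 < r" "r < 1" using le1 by linarith+
        have "r * \<bar>\<eta> x\<bar> < T" "T' < r * \<bar>\<eta>' x\<bar>"
          using r pos by (simp_all add: field_simps)
        then have "r *\<^sub>R x \<in> B" "T' < \<bar>\<eta>' (r *\<^sub>R x)\<bar>"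
          using in1[OF scaleW[OF x(1)], of r] abs[OF r01(1)] q1[OF r01] by auto
        then show False using height(2)[OF scaleW[OF x(1)], of r] by simp
      qed
      show "\<not> (T / \<bar>\<eta> x\<bar> < r \<and> r < T' / \<bar>\<eta>' x\<bar>)"
      proof
        assume r: "T / \<bar>\<eta> x\<bar> < r \<and> r < T' / \<bar>\<eta>' x\<bar>"
        then have r01: "0 < r" "r < 1" using le1 by linarith+
        have "r * \<bar>\<eta>' x\<bar> < T'" "T < r * \<bar>\<eta> x\<bar>"
          using r pos by (simp_all add: field_simps)
        then have "r *\<^sub>R x \<in> B" "T < \<bar>\<eta> (r *\<^sub>R x)\<bar>"
          using in2[OF scaleW[OF x(1)], of r] abs[OF r01(1)] q1[OF r01] qq'[OF scaleW[OF x(1)], of r] by auto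
        then show False using height(1)[OF scaleW[OF x(1)], of r] by simp
      qed
    qed
    then have "T' / \<bar>\<eta>' x\<bar> = T / \<bar>\<eta> x\<bar>"
      by (meson dense linorder_neq_iff)
    then show ?thesis using big T(1) T'(1) by (simp add: field_simps)
  qed
  \<comment> \<open>Near a counterexample all points satisfy \<open>q < 1\<close> and avoid
    \<open>B\<close>. Small shifts along \<open>d\<close> in both directions keep \<eta> but change
    \<open>\<eta>'\<close>, against \<open>ratio\<close>.\<close>
  have inside: "x \<in> B" if x: "x \<in> W" "q x < 1" for x
  proof (rule ccontr)
    assume "x \<notin> B"
    let ?U = "{s. q (x + s *\<^sub>R d) < 1} \<inter> {s. x + s *\<^sub>R d \<in> - B}"
    have "open {s. x + s *\<^sub>R d \<in> - B}"
      using open_vimage[of "- B" "\<lambda>s. x + s *\<^sub>R d"] compact_imp_closed[OF compact_B]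
      by (simp add: vimage_def open_Compl continuous_intros)
    moreover have "open {s. q (x + s *\<^sub>R d) < 1}"
      unfolding q_def linear_add[OF R(1)] linear_add[OF R(2)] linear_scale[OF R(1)] linear_scale[OF R(2)]
      by (intro open_Collect_less continuous_intros)
    ultimately have "open ?U" by (intro open_Int)
    moreover have "0 \<in> ?U" using x \<open>x \<notin> B\<close> by simp
    ultimately obtain e where e: "0 < e" "ball 0 e \<subseteq> ?U" using openE by blast
    then have "e / 2 \<in> ?U" "- e / 2 \<in> ?U"
      by (intro subsetD[OF e(2)]; simp)+
    then have mem: "q (x + (e/2) *\<^sub>R d) < 1" "x + (e/2) *\<^sub>R d \<notin> B" "q (x + (-e/2) *\<^sub>R d) < 1" "x + (-e/2) *\<^sub>R d \<notin> B"
      by auto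
    have inW: "x + s *\<^sub>R d \<in> W" for s
      using W(1) x(1) d(1) by (intro subspace_add subspace_scale)
    have "\<bar>\<eta>' x + s\<bar> * T = \<bar>\<eta> x\<bar> * T'" if "q (x + s *\<^sub>R d) < 1" "x + s *\<^sub>R d \<notin> B" for s
      using ratio[OF inW, of s] that d
      by (simp add: linear_add[OF R(1)] linear_add[OF R'(1)] linear_scale[OF R(1)] linear_scale[OF R'(1)])
    from this[of "e/2"] this[of "-e/2"] ratio[of x] mem x \<open>x \<notin> B\<close>
    have "\<bar>\<eta>' x + e/2\<bar> * T = \<bar>\<eta>' x\<bar> * T" "\<bar>\<eta>' x + -e/2\<bar> * T = \<bar>\<eta>' x\<bar> * T"
      by auto
    then have "\<bar>\<eta>' x + e/2\<bar> = \<bar>\<eta>' x\<bar>" "\<bar>\<eta>' x - e/2\<bar> = \<bar>\<eta>' x\<bar>"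
      using T(1) by auto
    then show False using e(1) by linarith
  qed
  have B_iff: "x \<in> B \<longleftrightarrow> q x \<le> 1" if x: "x \<in> W" for x
  proof
    assume "x \<in> B"
    have r: "r\<^sup>2 * q x \<le> 1" if "0 < r" "r < 1" for r
    proof -
      have "r * \<bar>\<eta> x\<bar> < T"
        using mult_strict_right_mono[OF \<open>r < 1\<close> T(1)] mult_left_mono[OF height(1)[OF x \<open>x \<in> B\<close>], of r]
          \<open>0 < r\<close> by linarith
      then have "\<bar>\<eta> (r *\<^sub>R x)\<bar> < T" using that by (simp add: linear_scale[OF R(1)] abs_mult)
      then show ?thesis
        using in1[OF scaleW[OF x], of r] scale_mem[OF \<open>x \<in> B\<close>, of r] that by (simp add: q_scale)
    qed
    show "q x \<le> 1"
    proof (rule ccontr)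
      assume "\<not> q x \<le> 1"
      \<comment> \<open>This value of \<open>r\<^sup>2\<close> is the midpoint of
        \<open>1 / q x\<close> and 1, so \<open>r\<^sup>2 * q x\<close> still exceeds 1.\<close>
      then have "(1 + 1 / q x) / 2 < 1" "0 < (1 + 1 / q x) / 2" by (auto simp: field_simps)
      then have "(1 + 1 / q x) / 2 * q x \<le> 1"
        using r[of "sqrt ((1 + 1 / q x) / 2)"] by simp
      then show False using \<open>\<not> q x \<le> 1\<close> by (simp add: field_simps)
    qed
  next
    assume "q x \<le> 1"
    show "x \<in> B"
    proof (rule mem_if_scaled_mem)
      fix r :: real assume r: "0 < r" "r < 1"
      have "r\<^sup>2 * q x < 1"
      proof (cases "q x \<le> 0")
        case True
        then show ?thesis using mult_nonneg_nonpos[of "r\<^sup>2" "q x"] by simp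
      next
        case False
        have "r\<^sup>2 * q x < 1 * q x" using False r by (intro mult_strict_right_mono) (auto simp: abs_square_less_1)
        then show ?thesis using \<open>q x \<le> 1\<close> by simp
      qed
      then show "r *\<^sub>R x \<in> B" using inside[OF scaleW[OF x]] by (simp add: q_scale)
    qed
  qed
  obtain e where e: "e \<in> W" "\<eta> e = 0" "norm (S e) = 1"
    using unit_vector_in_common_kernel[OF W R(1) reps(1)] by metis
  have "s\<^sup>2 \<le> \<phi> t \<longleftrightarrow> s\<^sup>2 + \<kappa> * t\<^sup>2 \<le> 1" for s t
  proof -
    have "t *\<^sub>R p + s *\<^sub>R e \<in> W" using W(1) R(3) e by (intro subspace_add subspace_scale)
    moreover have "q (t *\<^sub>R p + s *\<^sub>R e) = s\<^sup>2 + \<kappa> * t\<^sup>2"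
      using R(4,5) e
      by (simp add: q_def linear_add[OF R(1)] linear_add[OF R(2)] linear_scale[OF R(1)] linear_scale[OF R(2)])
    ultimately show ?thesis
      using B_iff slice_mem_iff[OF W(1) reps(1) e, of t s] by metis
  qed
  then show ?thesis unfolding elliptic_profile_def by blast
qed

text \<open>If the kernel of \<eta> in \<open>W\<close> lies in that of \<open>\<eta>'\<close>, the
  forms are proportional and the axes agree. Otherwise a vector in the first kernel only supplies
  the directions \<open>d\<close> and \<open>w\<close> that force an elliptic profile.\<close>

lemma axis_unique_or_elliptic:
  assumes W: "subspace W" "3 \<le> dim W"
    and reps: "revolution_rep W \<eta> S p \<phi>" "revolution_rep W \<eta>' S' p' \<phi>'"
  shows "(p' = \<eta> p' *\<^sub>R p \<and> (\<forall>x\<in>W. \<eta>' x = \<eta>' p * \<eta> x)) \<or> (\<exists>\<kappa>. elliptic_profile \<phi> \<kappa>)"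
proof (cases "\<forall>x\<in>W. \<eta> x = 0 \<longrightarrow> \<eta>' x = 0")
  note R = revolution_repD[OF reps(1)] and R' = revolution_repD[OF reps(2)]
  case True
  have "\<eta>' x = \<eta>' p * \<eta> x" if "x \<in> W" for x
  proof -
    have "\<eta>' (x - \<eta> x *\<^sub>R p) = 0"
      using True that W(1) R(3,4)
      by (auto simp: subspace_diff subspace_scale linear_diff[OF R(1)] linear_scale[OF R(1)])
    then show ?thesis by (simp add: linear_diff[OF R'(1)] linear_scale[OF R'(1)])
  qed
  then show ?thesis using axes_parallel_if_kernels_eq[OF W(1) reps] True by blast
next
  note R = revolution_repD[OF reps(1)] and R' = revolution_repD[OF reps(2)]
  case False
  then obtain y where y: "y \<in> W" "\<eta> y = 0" "\<eta>' y \<noteq> 0" by blast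
  define d where "d = (1 / \<eta>' y) *\<^sub>R y"
  have d: "d \<in> W" "\<eta> d = 0" "\<eta>' d = 1"
    using y W(1) by (auto simp: d_def subspace_scale linear_scale[OF R(1)] linear_scale[OF R'(1)])
  \<comment> \<open>Subtracting this multiple of \<open>d\<close> from \<open>p\<close> cancels the
    height \<open>\<eta>'\<close> and leaves the height \<eta> at 1.\<close>
  define w where "w = p - \<eta>' p *\<^sub>R d"
  have "w \<in> W" "\<eta>' w = 0" "\<eta> w = 1"
    using d R(3,4) W(1)
    by (auto simp: w_def subspace_diff subspace_scale linear_diff[OF R(1)] linear_scale[OF R(1)]
        linear_diff[OF R'(1)] linear_scale[OF R'(1)])
  then show ?thesis using elliptic_if_kernels_neq[OF W reps _ _ _ d] by blast
qed

section \<open>Comparing the axes of two hyperplane sections\<close>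

text \<open>A section of a body of revolution by a subspace \<open>W\<close> is again one; tilting \<open>W\<close> away from the
  axis only subtracts a quadratic term from the profile.\<close>

lemma tilted_section_rep:
  assumes W: "subspace W" "W \<subseteq> V" and rep: "revolution_rep V \<eta> S p \<phi>"
    and y: "y \<in> W" "\<eta> y \<noteq> 0"
  obtains m S' where "m \<in> W" "\<eta> m = 1"
    "revolution_rep W \<eta> S' m (\<lambda>t. \<phi> t - (norm (S m))\<^sup>2 * t\<^sup>2)"
proof -
  note R = revolution_repD[OF rep]
  note lin = linear_add[OF R(1)] linear_add[OF R(2)] linear_scale[OF R(1)] linear_scale[OF R(2)]
      linear_diff[OF R(1)] linear_diff[OF R(2)]
  define Q where "Q = {x \<in> W. \<eta> x = 0}"
  have subQ: "subspace Q"
    using W(1) by (auto simp: Q_def subspace_def lin linear_0[OF R(1)])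
  define m0 where "m0 = (1 / \<eta> y) *\<^sub>R y"
  have m0: "m0 \<in> W" "\<eta> m0 = 1"
    using y W(1) by (auto simp: m0_def subspace_scale lin)
  have "subspace (S ` Q)" using R(2) subQ by (rule linear_subspace_image)
  then have spanSQ: "span (S ` Q) = S ` Q" by (rule span_eq_iff[THEN iffD2])
  \<comment> \<open>The axis of the section comes from an orthogonal projection: \<open>m0\<close>
    is corrected by an element of \<open>Q\<close>, hence at constant height, until its image under
    \<open>S\<close> is orthogonal to the image of \<open>Q\<close>.\<close>
  obtain a b where ab: "a \<in> span (S ` Q)" "\<And>w. w \<in> span (S ` Q) \<Longrightarrow> orthogonal b w" "S m0 = a + b"
    using orthogonal_subspace_decomp_exists[of "S ` Q" "S m0"] by blast
  then obtain y0 where y0: "y0 \<in> Q" "a = S y0" using spanSQ by auto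
  define m where "m = m0 - y0"
  have m: "m \<in> W" "\<eta> m = 1" "S m = b"
    using m0 y0 ab(3) W(1) by (auto simp: m_def Q_def lin subspace_diff)
  \<comment> \<open>On \<open>W\<close> this is the projection along \<open>m\<close> onto
    \<open>Q\<close> followed by \<open>S\<close>. By Pythagoras the part projected away contributes
    the quadratic term of the new profile.\<close>
  define S' where "S' = (\<lambda>x. S (x - \<eta> x *\<^sub>R m))"
  have "linear S'"
    unfolding S'_def
    by (intro linearI) (simp_all add: lin scaleR_add_left scaleR_diff_right algebra_simps)
  have pyth: "(norm (S x))\<^sup>2 = (norm (S' x))\<^sup>2 + (norm (S m))\<^sup>2 * (\<eta> x)\<^sup>2" if x: "x \<in> W" for x
  proof -
    have "x - \<eta> x *\<^sub>R m \<in> Q"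
      using x m W(1) by (auto simp: Q_def lin subspace_diff subspace_scale)
    then have "orthogonal b (S' x)"
      using ab(2) spanSQ by (auto simp: S'_def)
    then have "orthogonal (S' x) (\<eta> x *\<^sub>R b)"
      by (simp add: orthogonal_def inner_commute)
    then have "(norm (S' x + \<eta> x *\<^sub>R b))\<^sup>2 = (norm (S' x))\<^sup>2 + (norm (\<eta> x *\<^sub>R b))\<^sup>2"
      by (rule norm_add_Pythagorean)
    moreover have "S' x + \<eta> x *\<^sub>R b = S x"
      using m(3) by (simp add: S'_def lin)
    ultimately show ?thesis using m(3) by (simp add: power_mult_distrib)
  qed
  have "revolution_rep W \<eta> S' m (\<lambda>t. \<phi> t - (norm (S m))\<^sup>2 * t\<^sup>2)"
    unfolding revolution_rep_def
  proof (intro conjI ballI impI)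
    show "S' m = 0" using m(2) by (simp add: S'_def linear_0[OF R(2)])
    show "y = 0" if "y \<in> W" "\<eta> y = 0" "S' y = 0" for y
      using that W(2) R(7) by (auto simp: S'_def)
    show "x \<in> B \<longleftrightarrow> (norm (S' x))\<^sup>2 \<le> \<phi> (\<eta> x) - (norm (S m))\<^sup>2 * (\<eta> x)\<^sup>2" if "x \<in> W" for x
      using R(8)[of x] pyth[OF that] W(2) that by auto
  qed (use R m \<open>linear S'\<close> in auto)
  then show ?thesis using that m by blast
qed

text \<open>Inside the hyperplane of revolution of \<open>V\<close> the section is the ellipsoid
  \<open>norm (S' x) \<le> 1\<close>. In the plane of \<open>p\<close> and \<open>e\<close> it is an
  ellipse symmetric in \<open>s\<close>, so the mixed term \<open>b\<close> vanishes.\<close>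

lemma elliptic_if_section_in_kernel:
  assumes W: "subspace W" "3 \<le> dim W" "W \<subseteq> V"
    and reps: "revolution_rep W \<eta> S p \<phi>" "revolution_rep V \<eta>' S' p' \<phi>'"
    and ker: "\<And>x. x \<in> W \<Longrightarrow> \<eta>' x = 0"
  shows "\<exists>\<kappa>. elliptic_profile \<phi> \<kappa>"
proof -
  note R = revolution_repD[OF reps(1)] and R' = revolution_repD[OF reps(2)]
  obtain T where T: "0 < T" "\<And>t. t *\<^sub>R p \<in> B \<longleftrightarrow> \<bar>t\<bar> \<le> T"
    using line_section[OF revolution_rep_nonzero[OF reps(1)]] by blast
  obtain e where e: "e \<in> W" "\<eta> e = 0" "norm (S e) = 1"
    using unit_vector_in_common_kernel[OF W(1,2) R(1) reps(1)] by metis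
  note slice = slice_mem_iff[OF W(1) reps(1) e]
  have mem: "x \<in> B \<longleftrightarrow> (norm (S' x))\<^sup>2 \<le> 1" if "x \<in> W" for x
    using R'(6) R'(8)[of x] ker[OF that] W(3) that by auto
  have e': "norm (S' e) = 1"
  proof -
    let ?n = "norm (S' e)"
    have *: "s\<^sup>2 \<le> 1 \<longleftrightarrow> (s * ?n)\<^sup>2 \<le> 1" for s
      using slice[of 0 s] mem[of "s *\<^sub>R e"] subspace_scale[OF W(1) e(1)] R(6)
      by (simp add: linear_scale[OF R'(2)] power_mult_distrib)
    have "?n \<noteq> 0" using *[of 2] by auto
    then have "0 < ?n" by simp
    then show ?thesis
      using *[of 1] *[of "1 / ?n"] by (simp add: power_le_one_iff)
  qed
  define b where "b = S' p \<bullet> S' e"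
  have eq: "s\<^sup>2 \<le> \<phi> t \<longleftrightarrow> (s + t * b)\<^sup>2 \<le> 1 - t\<^sup>2 * (norm (S' p))\<^sup>2 + (t * b)\<^sup>2" for s t
  proof -
    have "t *\<^sub>R p + s *\<^sub>R e \<in> W"
      using W(1) R(3) e(1) by (intro subspace_add subspace_scale)
    moreover have "S' (t *\<^sub>R p + s *\<^sub>R e) = t *\<^sub>R S' p + s *\<^sub>R S' e"
      by (simp add: linear_add[OF R'(2)] linear_scale[OF R'(2)])
    ultimately show ?thesis
      using slice[of t s] mem[of "t *\<^sub>R p + s *\<^sub>R e"] norm_add_scaleR_unit[OF e', of "t *\<^sub>R S' p" s]
      by (auto simp: b_def power_mult_distrib)
  qed
  \<comment> \<open>The slice at height \<open>T\<close> is nonempty; its chord along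
    \<open>e\<close> has centre 0 in one description and \<open>- (T * b)\<close> in the
    other.\<close>
  have "0 \<le> \<phi> T" using T profile_domain[OF W(1) reps(1)] by simp
  then have "0 = T * b"
    by (intro interval_centre_radius_unique(1)[of 0 "\<phi> T" "T * b" "1 - T\<^sup>2 * (norm (S' p))\<^sup>2 + (T * b)\<^sup>2"])
      (use eq[of _ T] in auto)
  then have "b = 0" using T(1) by simp
  then have "s\<^sup>2 \<le> \<phi> t \<longleftrightarrow> s\<^sup>2 + (norm (S' p))\<^sup>2 * t\<^sup>2 \<le> 1" for s t
    using eq[of s t] by (auto simp: algebra_simps)
  then show ?thesis unfolding elliptic_profile_def by blast
qed

text \<open>If \<open>W\<close> lies in the hyperplane of revolution of \<open>V'\<close>, its
  section is an ellipsoid. Otherwise the axis \<open>p\<close> of the section is compared with the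
  axis \<open>m\<close> obtained from \<open>V'\<close>: unless the profile is elliptic, the tilt
  \<open>S' m\<close> vanishes, and then \<open>m\<close> is \<open>p'\<close>.\<close>

lemma axes_parallel_or_elliptic:
  assumes W: "subspace W" "3 \<le> dim W" "W \<subseteq> V" "W \<subseteq> V'" "p \<in> W" and V': "subspace V'"
    and reps: "revolution_rep V \<eta> S p \<phi>" "revolution_rep V' \<eta>' S' p' \<phi>"
  shows "(\<exists>c. p' = c *\<^sub>R p) \<or> (\<exists>\<kappa>. elliptic_profile \<phi> \<kappa>)"
proof (cases "\<forall>x\<in>W. \<eta>' x = 0")
  case True
  then show ?thesis
    using elliptic_if_section_in_kernel[OF W(1,2,4) revolution_rep_subset[OF reps(1) W(3,5)] reps(2)]
    by blast
next
  case False
  note rep = revolution_rep_subset[OF reps(1) W(3,5)]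
  note R = revolution_repD[OF rep] and R' = revolution_repD[OF reps(2)]
  obtain y where "y \<in> W" "\<eta>' y \<noteq> 0" using False by blast
  then obtain m S2 where m: "m \<in> W" "\<eta>' m = 1"
    and rep2: "revolution_rep W \<eta>' S2 m (\<lambda>t. \<phi> t - (norm (S' m))\<^sup>2 * t\<^sup>2)"
    using tilted_section_rep[OF W(1,4) reps(2)] by blast
  show ?thesis
  proof (rule disjCI)
    assume "\<nexists>\<kappa>. elliptic_profile \<phi> \<kappa>"
    then have ax: "m = \<eta> m *\<^sub>R p" and h: "\<And>x. x \<in> W \<Longrightarrow> \<eta>' x = \<eta>' p * \<eta> x"
      using axis_unique_or_elliptic[OF W(1,2) rep rep2] by blast+
    obtain T where T: "0 < T" "\<And>t. t *\<^sub>R p \<in> B \<longleftrightarrow> \<bar>t\<bar> \<le> T"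
      using line_section[OF revolution_rep_nonzero[OF rep]] by blast
    obtain e where e: "e \<in> W" "\<eta> e = 0" "norm (S e) = 1"
      using unit_vector_in_common_kernel[OF W(1,2) R(1) rep] by metis
    have e': "\<eta>' e = 0" using h[OF e(1)] e(2) by simp
    \<comment> \<open>The factor converting heights: \<open>p\<close> is \<open>k\<close> times
      \<open>m\<close>, so height \<open>t\<close> along \<open>p\<close> is height
      \<open>k * t\<close> along \<open>m\<close>.\<close>
    define k where "k = \<eta>' p"
    have k: "k * \<eta> m = 1" using h[OF m(1)] m(2) by (simp add: k_def)
    then have "k \<noteq> 0" by auto
    have p: "p = k *\<^sub>R m" using k by (subst ax) simp
    have n2: "norm (S2 e) = 1"
      using reps_agree_on_common_kernel[OF W(1) rep rep2 e(1,2) e'] e(3) by simp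
    let ?a = "(norm (S' m))\<^sup>2 * k\<^sup>2"
    have "s\<^sup>2 \<le> \<phi> t \<longleftrightarrow> s\<^sup>2 \<le> \<phi> (k * t) - ?a * t\<^sup>2" for s t
      using slice_mem_iff[OF W(1) rep e, of t s] slice_mem_iff[OF W(1) rep2 e(1) e' n2, of "k * t" s]
      by (subst (asm) p) (simp add: power_mult_distrib mult_ac)
    then have "\<not> 0 < ?a"
      using elliptic_profile_if_self_similar[of \<phi> k ?a T] T profile_domain[OF W(1) rep]
        profile_isCont_0[OF W(1,2) rep] R(6) \<open>\<nexists>\<kappa>. elliptic_profile \<phi> \<kappa>\<close> by blast
    then have "S' m = 0"
      using \<open>k \<noteq> 0\<close> by (simp add: zero_less_mult_iff)
    have "m - p' \<in> V'"
      using m(1) R'(3) W(4) by (intro subspace_diff V') auto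
    moreover have "\<eta>' (m - p') = 0"
      using m(2) R'(4) by (simp only: linear_diff[OF R'(1)])
    moreover have "S' (m - p') = 0"
      using \<open>S' m = 0\<close> R'(5) by (simp add: linear_diff[OF R'(2)])
    ultimately have "m - p' = 0"
      by (rule R'(7))
    then have "p' = m" by (rule eq_iff_diff_eq_0[THEN iffD2, symmetric])
    have "p' = \<eta> m *\<^sub>R p"
      by (rule trans[OF \<open>p' = m\<close> ax])
    then show "\<exists>c. p' = c *\<^sub>R p" by blast
  qed
qed

section \<open>Existence of representations and their transport by linear equivalences\<close>

text \<open>Pulling \<eta> and \<open>S\<close> back along \<open>f\<close> leaves \<phi> untouched,
  so linearly equivalent sections share one profile.\<close>

lemma revolution_rep_transport:
  assumes rep: "revolution_rep V \<eta> S p \<phi>"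
    and f: "linear f" "inj_on f V'" "f ` V' = V" "f ` (V' \<inter> B) = V \<inter> B" and V': "subspace V'"
  shows "\<exists>\<eta>' S' p'. revolution_rep V' \<eta>' S' p' \<phi>"
proof -
  note R = revolution_repD[OF rep]
  obtain p' where p': "p' \<in> V'" "f p' = p" using R(3) f(3) by auto
  have mem: "x \<in> B \<longleftrightarrow> f x \<in> B" if x: "x \<in> V'" for x
  proof
    assume "x \<in> B"
    then show "f x \<in> B" using x f(4) by blast
  next
    assume "f x \<in> B"
    then have "f x \<in> f ` (V' \<inter> B)" using x f(3,4) by blast
    then show "x \<in> B" using x f(2) by (auto dest: inj_onD)
  qed
  have ker: "y = 0" if "y \<in> V'" "f y = 0" for y
    using f(2) that subspace_0[OF V'] linear_0[OF f(1)] by (metis inj_onD)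
  have "revolution_rep V' (\<eta> \<circ> f) (S \<circ> f) p' \<phi>"
    unfolding revolution_rep_def
  proof (intro conjI ballI impI)
    fix x assume x: "x \<in> V'"
    then have "f x \<in> V" using f(3) by blast
    then show "x \<in> B \<longleftrightarrow> (norm ((S \<circ> f) x))\<^sup>2 \<le> \<phi> ((\<eta> \<circ> f) x)"
      using R(8) mem[OF x] by simp
    show "x = 0" if "(\<eta> \<circ> f) x = 0" "(S \<circ> f) x = 0"
      using R(7)[OF \<open>f x \<in> V\<close>] that ker[OF x] by simp
  qed (use R p' f(1) in \<open>auto intro: linear_compose\<close>)
  then show ?thesis by blast
qed

lemma ex_revolution_rep:
  assumes H: "subspace H" "3 \<le> dim H" and rev: "affine_sym_body_of_revolution_in H (H \<inter> B)"
  shows "\<exists>\<eta> S p \<phi>. revolution_rep H \<eta> S p \<phi>"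
proof -
  obtain K where "sym_body_of_revolution_in H K" "lin_equiv_in H (H \<inter> B) H K"
    using rev unfolding affine_sym_body_of_revolution_in_def by blast
  then obtain g u where g: "linear g" "inj_on g H" "g ` H = H" "g ` (H \<inter> B) = K"
    and "axis_of_revolution_in H K u"
    unfolding lin_equiv_in_def sym_body_of_revolution_in_def by auto
  then have u: "u \<in> H" "norm u = 1"
    and ex: "\<forall>t::real. \<exists>r. K \<inter> {x \<in> H. x \<bullet> u = t} = cball (t *\<^sub>R u) r \<inter> {x \<in> H. x \<bullet> u = t}"
    unfolding axis_of_revolution_in_def by auto
  obtain r where r: "\<And>t::real. K \<inter> {x \<in> H. x \<bullet> u = t} = cball (t *\<^sub>R u) (r t) \<inter> {x \<in> H. x \<bullet> u = t}"
    using choice[OF ex] by blast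
  \<comment> \<open>Squaring alone would turn a negative radius, that is an empty slice, into a
    ball; the value -1 keeps the slice empty.\<close>
  define \<psi> where "\<psi> t = (if r t < 0 then - 1 else (r t)\<^sup>2)" for t
  define P where "P x = g x - (g x \<bullet> u) *\<^sub>R u" for x
  have linP: "linear P"
    by (intro linearI) (simp_all add: P_def linear_add[OF g(1)] linear_scale[OF g(1)] inner_add_left
        scaleR_add_left scaleR_diff_right)
  have uu: "u \<bullet> u = 1" using u(2) by (simp add: norm_eq_1)
  have gH: "g x \<in> H" if "x \<in> H" for x using g(3) that by blast
  have memK: "x \<in> B \<longleftrightarrow> g x \<in> K" if x: "x \<in> H" for x
  proof
    assume "x \<in> B"
    then show "g x \<in> K" using x g(4) by blast
  next
    assume "g x \<in> K"
    then have "g x \<in> g ` (H \<inter> B)" using g(4) by blast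
    then show "x \<in> B" using x g(2) by (auto dest: inj_onD)
  qed
  have mem: "x \<in> B \<longleftrightarrow> (norm (P x))\<^sup>2 \<le> \<psi> (g x \<bullet> u)" if x: "x \<in> H" for x
  proof -
    have "g x \<in> K \<longleftrightarrow> g x \<in> cball ((g x \<bullet> u) *\<^sub>R u) (r (g x \<bullet> u))"
      using r[of "g x \<bullet> u"] gH[OF x] by blast
    also have "\<dots> \<longleftrightarrow> norm (P x) \<le> r (g x \<bullet> u)"
      by (simp add: P_def dist_norm norm_minus_commute)
    also have "\<dots> \<longleftrightarrow> (norm (P x))\<^sup>2 \<le> \<psi> (g x \<bullet> u)"
    proof (cases "r (g x \<bullet> u) < 0")
      case True
      then have "\<not> norm (P x) \<le> r (g x \<bullet> u)" using norm_ge_zero[of "P x"] by linarith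
      moreover have "\<not> (norm (P x))\<^sup>2 \<le> \<psi> (g x \<bullet> u)"
        using True less_le_trans[of "- 1" 0 "(norm (P x))\<^sup>2"] by (simp add: \<psi>_def not_le)
      ultimately show ?thesis by simp
    next
      case False
      then show ?thesis by (simp add: \<psi>_def power_mono_iff)
    qed
    finally show ?thesis using memK[OF x] by simp
  qed
  have ker: "y = 0" if "y \<in> H" "g y = 0" for y
    using g(2) that subspace_0[OF H(1)] linear_0[OF g(1)] by (metis inj_onD)
  have \<eta>: "linear (\<lambda>x. g x \<bullet> u)"
    by (intro linearI) (simp_all add: linear_add[OF g(1)] linear_scale[OF g(1)] inner_add_left)
  \<comment> \<open>A nonzero vector of height 0, shrunk into \<open>B\<close>, shows that the
    central radius is positive, so that it can be normalised to 1.\<close>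
  obtain y where y: "y \<in> H" "y \<noteq> 0" "g y \<bullet> u = 0"
    using common_kernel_vector[OF H \<eta> \<eta>] by blast
  obtain c where c: "0 < c" "c *\<^sub>R y \<in> B"
    using absorbing[of y] by (metis abs_of_pos order_refl)
  have "(norm (P (c *\<^sub>R y)))\<^sup>2 \<le> \<psi> 0"
    using mem[of "c *\<^sub>R y"] c(2) y subspace_scale[OF H(1) y(1)] by (simp add: linear_scale[OF g(1)])
  moreover have "P (c *\<^sub>R y) \<noteq> 0"
    using y ker[OF y(1)] c(1) by (auto simp: P_def linear_scale[OF g(1)])
  ultimately have pos: "0 < \<psi> 0"
    by (meson less_le_trans zero_less_norm_iff zero_less_power)
  obtain p where p: "p \<in> H" "g p = u" using g(3) u(1) by (metis imageE)
  have "revolution_rep H (\<lambda>x. g x \<bullet> u) (\<lambda>x. (1 / sqrt (\<psi> 0)) *\<^sub>R P x) p (\<lambda>t. \<psi> t / \<psi> 0)"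
    unfolding revolution_rep_def
  proof (intro conjI ballI impI)
    show "linear (\<lambda>x. (1 / sqrt (\<psi> 0)) *\<^sub>R P x)"
      using linP by (intro linearI) (simp_all add: linear_add linear_scale scaleR_add_right)
    show "y = 0" if "y \<in> H" "g y \<bullet> u = 0" "(1 / sqrt (\<psi> 0)) *\<^sub>R P y = 0" for y
      using that pos ker by (simp add: P_def)
    show "x \<in> B \<longleftrightarrow> (norm ((1 / sqrt (\<psi> 0)) *\<^sub>R P x))\<^sup>2 \<le> \<psi> (g x \<bullet> u) / \<psi> 0" if "x \<in> H" for x
      using mem[OF that] pos by (simp add: power_divide divide_le_cancel)
  qed (use p pos uu \<eta> in \<open>simp_all add: P_def\<close>)
  then show ?thesis by blast
qed

text \<open>Boundedness forces \<open>0 < \<kappa>\<close>, since the axis has left \<open>B\<close>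
  at height \<open>2 * T\<close>. The height, scaled by \<open>sqrt \<kappa>\<close>, then serves as
  one more Euclidean coordinate.\<close>

lemma quadratic_section_if_elliptic:
  assumes "subspace V" "revolution_rep V \<eta> S p \<phi>" "elliptic_profile \<phi> \<kappa>"
  shows "\<exists>g :: 'a \<Rightarrow> 'a \<times> real. linear g \<and> (\<forall>x\<in>V. x \<in> B \<longleftrightarrow> norm (g x) \<le> 1)"
proof -
  note R = revolution_repD[OF assms(2)]
  have ell: "s\<^sup>2 \<le> \<phi> t \<longleftrightarrow> s\<^sup>2 + \<kappa> * t\<^sup>2 \<le> 1" for s t
    using assms(3) unfolding elliptic_profile_def by blast
  obtain T where T: "0 < T" "\<And>t. t *\<^sub>R p \<in> B \<longleftrightarrow> \<bar>t\<bar> \<le> T"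
    using line_section[OF revolution_rep_nonzero[OF assms(2)]] by blast
  have "\<not> 0 \<le> \<phi> (2 * T)"
    using T profile_domain[OF assms(1,2)] by simp
  then have "1 < \<kappa> * (2 * T)\<^sup>2" using ell[of 0 "2 * T"] by simp
  then have "0 < \<kappa>" by (smt (verit) mult_nonneg_nonneg mult_nonpos_nonneg zero_le_power2)
  let ?g = "\<lambda>x. (S x, sqrt \<kappa> * \<eta> x)"
  have "linear ?g"
    by (intro linearI) (simp_all add: linear_add[OF R(1)] linear_add[OF R(2)] linear_scale[OF R(1)]
        linear_scale[OF R(2)] algebra_simps)
  moreover have "x \<in> B \<longleftrightarrow> norm (?g x) \<le> 1" if "x \<in> V" for x
    using R(8)[OF that] ell[of "norm (S x)" "\<eta> x"] \<open>0 < \<kappa>\<close>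
    by (simp add: norm_Pair power_mult_distrib)
  ultimately show ?thesis by blast
qed

section \<open>Bodies with ellipsoidal hyperplane sections\<close>

text \<open>The squared gauge \<open>q\<close> is quadratic on every hyperplane, and any three
  vectors share one, so its polarisation \<open>b\<close> is bilinear. Splitting off a vector
  \<open>v\<close> that is \<open>b\<close>-orthogonal to a hyperplane \<open>H\<close> writes
  \<open>q\<close> globally as a squared norm.\<close>

lemma is_ellipsoid_if_quadratic_sections:
  assumes dim4: "4 \<le> DIM('a)"
    and sec: "\<And>H. linear_hyperplane H \<Longrightarrow>
      \<exists>g :: 'a \<Rightarrow> 'a \<times> real. linear g \<and> (\<forall>x\<in>H. x \<in> B \<longleftrightarrow> norm (g x) \<le> 1)"
  shows "is_ellipsoid B"
proof -
  obtain G :: "'a set \<Rightarrow> 'a \<Rightarrow> 'a \<times> real" where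
    lin: "\<And>H. linear_hyperplane H \<Longrightarrow> linear (G H)" and
    mem: "\<And>H x. linear_hyperplane H \<Longrightarrow> x \<in> H \<Longrightarrow> x \<in> B \<longleftrightarrow> norm (G H x) \<le> 1"
    using sec by metis
  have scale: "c *\<^sub>R x \<in> H" if "linear_hyperplane H" "x \<in> H" for c x and H :: "'a set"
    using that by (auto simp: linear_hyperplane_def subspace_scale)
  have memc: "c *\<^sub>R x \<in> B \<longleftrightarrow> \<bar>c\<bar> * norm (G H x) \<le> 1" if "linear_hyperplane H" "x \<in> H" for c x H
    using mem[OF that(1) scale[OF that]] by (simp add: linear_scale[OF lin[OF that(1)]])
  have nz: "0 < norm (G H x)" if H: "linear_hyperplane H" "x \<in> H" "x \<noteq> 0" for H x
  proof (rule ccontr)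
    assume "\<not> 0 < norm (G H x)"
    then have "t *\<^sub>R x \<in> B" for t using memc[OF H(1,2)] by simp
    moreover obtain T where "\<And>t. t *\<^sub>R x \<in> B \<longleftrightarrow> \<bar>t\<bar> \<le> T" using line_section[OF H(3)] by blast
    ultimately have "\<bar>\<bar>T\<bar> + 1\<bar> \<le> T" by blast
    then show False by linarith
  qed
  have G_unique: "norm (G H x) = norm (G H' x)"
    if H: "linear_hyperplane H" "x \<in> H" and H': "linear_hyperplane H'" "x \<in> H'" for H H' x
  proof (cases "x = 0")
    case True
    then show ?thesis using linear_0[OF lin[OF H(1)]] linear_0[OF lin[OF H'(1)]] by simp
  next
    case False
    note pos = nz[OF H False] nz[OF H' False]
    have "\<bar>c\<bar> * norm (G H x) \<le> 1 \<longleftrightarrow> \<bar>c\<bar> * norm (G H' x) \<le> 1" for c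
      using memc[OF H] memc[OF H'] by blast
    from this[of "1 / norm (G H x)"] this[of "1 / norm (G H' x)"] show ?thesis
      using pos by (simp add: divide_le_eq)
  qed
  define q where "q x = (norm (G (hyperplane_through x x x) x))\<^sup>2" for x
  have q: "q x = (norm (G H x))\<^sup>2" if "linear_hyperplane H" "x \<in> H" for H x
    using G_unique[OF that] hyperplane_through[OF dim4, of x x x] by (simp add: q_def)
  define b where "b x y = (q (x + y) - q (x - y)) / 4" for x y
  have b: "b x y = G H x \<bullet> G H y" if H: "linear_hyperplane H" "x \<in> H" "y \<in> H" for H x y
  proof -
    have "x + y \<in> H" "x - y \<in> H"
      using H by (auto simp: linear_hyperplane_def subspace_add subspace_diff)
    then show ?thesis
      using q[OF H(1)] unfolding b_def power2_norm_eq_inner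
      by (simp add: linear_add[OF lin[OF H(1)]] linear_diff[OF lin[OF H(1)]] inner_add_left
          inner_add_right inner_diff_left inner_diff_right inner_commute)
  qed
  have b_add: "b v (x + y) = b v x + b v y" for v x y
  proof -
    let ?H = "hyperplane_through v x y"
    have H: "linear_hyperplane ?H" "v \<in> ?H" "x \<in> ?H" "y \<in> ?H"
      using hyperplane_through[OF dim4] by auto
    then have "x + y \<in> ?H" by (auto simp: linear_hyperplane_def subspace_add)
    then show ?thesis
      using b[OF H(1)] H by (simp add: linear_add[OF lin[OF H(1)]] inner_add_right)
  qed
  have b_scale: "b v (c *\<^sub>R x) = c * b v x" for v x c
  proof -
    let ?H = "hyperplane_through v x x"
    have H: "linear_hyperplane ?H" "v \<in> ?H" "x \<in> ?H"
      using hyperplane_through[OF dim4] by auto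
    then show ?thesis
      using b[OF H(1)] scale[OF H(1)] by (simp add: linear_scale[OF lin[OF H(1)]])
  qed
  obtain n :: 'a where n: "n \<noteq> 0" using vector_choose_size[of 1] by (metis norm_zero zero_le_one zero_neq_one)
  define H where "H = {x. n \<bullet> x = 0}"
  have H: "linear_hyperplane H"
    using n by (simp add: H_def linear_hyperplane_def subspace_hyperplane dim_hyperplane)
  then have subH: "subspace H" by (simp add: linear_hyperplane_def)
  let ?g = "G H"
  have "inj_on ?g H"
    using nz[OF H] by (subst linear_injective_on_subspace_0[OF lin[OF H] subH]) fastforce
  then obtain j where j: "range j \<subseteq> H" "linear j" "\<And>v. v \<in> H \<Longrightarrow> j (?g v) = v"
    using linear_exists_left_inverse_on[OF lin[OF H] subH] by blast
  \<comment> \<open>Riesz representation of \<open>b n\<close> on \<open>H\<close>: the left inverse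
    \<open>j\<close> moves the functional to the codomain of \<open>?g\<close>, where the adjoint
    yields a vector \<open>a\<close>. Projecting \<open>a\<close> onto the image of \<open>H\<close>
    gives \<open>h\<close> in \<open>H\<close> such that \<open>b n\<close> and \<open>b h\<close>
    agree on \<open>H\<close>.\<close>
  have "linear (\<lambda>w. b n (j w))"
    by (intro linearI) (simp_all add: linear_add[OF j(2)] linear_scale[OF j(2)] b_add b_scale)
  then have riesz: "b n (j w) = w \<bullet> adjoint (\<lambda>w. b n (j w)) 1" for w
    using adjoint_works[of "\<lambda>w. b n (j w)" w 1] by (simp add: inner_commute)
  define a where "a = adjoint (\<lambda>w. b n (j w)) 1"
  have "subspace (?g ` H)" using lin[OF H] subH by (rule linear_subspace_image)
  then have span: "span (?g ` H) = ?g ` H" by (rule span_eq_iff[THEN iffD2])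
  obtain a1 a2 where a12: "a1 \<in> span (?g ` H)" "\<And>w. w \<in> span (?g ` H) \<Longrightarrow> orthogonal a2 w" "a = a1 + a2"
    using orthogonal_subspace_decomp_exists[of "?g ` H" a] by blast
  then obtain h where h: "h \<in> H" "a1 = ?g h" using span by auto
  have bn: "b n y = b h y" if y: "y \<in> H" for y
  proof -
    have "b n y = ?g y \<bullet> a" using riesz[of "?g y"] j(3)[OF y] by (simp add: a_def)
    also have "\<dots> = ?g y \<bullet> ?g h"
      using a12(2)[of "?g y"] a12(3) span y h(2)
      by (simp add: inner_add_right orthogonal_def inner_commute)
    finally show ?thesis using b[OF H h(1) y] by (simp add: inner_commute)
  qed
  have b_sym: "b x y = b y x" for x y
  proof -
    let ?H = "hyperplane_through x y y"
    have "linear_hyperplane ?H" "x \<in> ?H" "y \<in> ?H" using hyperplane_through[OF dim4] by auto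
    then show ?thesis by (simp add: b inner_commute)
  qed
  define v where "v = n - h"
  have bv: "b y v = 0" if "y \<in> H" for y
  proof -
    have "b y n = b y v + b y h" using b_add[of y v h] by (simp add: v_def)
    then show ?thesis using bn[OF that] b_sym[of y n] b_sym[of y h] by simp
  qed
  have nv: "n \<bullet> v = n \<bullet> n" "n \<bullet> n \<noteq> 0" using h n by (auto simp: v_def H_def inner_diff_right)
  define t where "t x = (n \<bullet> x) / (n \<bullet> n)" for x
  have t: "linear t" by (intro linearI) (simp_all add: t_def inner_add_right add_divide_distrib)
  have tH: "x - t x *\<^sub>R v \<in> H" for x
    using nv by (simp add: H_def t_def inner_diff_right)
  \<comment> \<open>The splitting of \<open>x\<close> along \<open>H\<close> and \<open>v\<close> is
    orthogonal for \<open>b\<close>, so \<open>q\<close> is the sum of its values on the two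
    parts.\<close>
  define F where "F x = (?g (x - t x *\<^sub>R v), t x * sqrt (q v))" for x
  have "linear F"
    by (intro linearI) (simp_all add: F_def linear_add[OF t] linear_scale[OF t] scaleR_add_left
        algebra_simps flip: linear_add[OF lin[OF H]] linear_scale[OF lin[OF H]])
  have "0 \<le> q v" by (simp add: q_def)
  have qF: "q x = (norm (F x))\<^sup>2" for x
  proof -
    define y where "y = x - t x *\<^sub>R v"
    have x: "x = y + t x *\<^sub>R v" by (simp add: y_def)
    let ?K = "hyperplane_through x y v"
    have K: "linear_hyperplane ?K" "x \<in> ?K" "y \<in> ?K" "v \<in> ?K"
      using hyperplane_through[OF dim4] by auto
    have "G ?K y \<bullet> G ?K v = 0" using b[OF K(1,3,4)] bv[of y] tH by (simp add: y_def)
    moreover have "G ?K x = G ?K y + t x *\<^sub>R G ?K v"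
      using x linear_add[OF lin[OF K(1)], of y "t x *\<^sub>R v"] linear_scale[OF lin[OF K(1)], of "t x" v] by simp
    ultimately have "(norm (G ?K x))\<^sup>2 = (norm (G ?K y))\<^sup>2 + (norm (t x *\<^sub>R G ?K v))\<^sup>2"
      by (simp add: norm_add_Pythagorean orthogonal_def)
    then have "q x = q y + (t x)\<^sup>2 * q v"
      using q[OF K(1)] K by (simp add: power_mult_distrib)
    also have "q y = (norm (?g y))\<^sup>2" using q[OF H] tH by (simp add: y_def)
    finally show ?thesis
      using \<open>0 \<le> q v\<close> by (simp add: F_def norm_Pair power_mult_distrib flip: y_def)
  qed
  have B_iff: "x \<in> B \<longleftrightarrow> norm (F x) \<le> 1" for x
  proof -
    have "x \<in> B \<longleftrightarrow> norm (G (hyperplane_through x x x) x) \<le> 1"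
      using mem hyperplane_through[OF dim4, of x x x] by blast
    moreover have "norm (G (hyperplane_through x x x) x) = norm (F x)"
      using qF[of x] unfolding q_def by (metis norm_ge_zero power2_eq_imp_eq)
    ultimately show ?thesis by simp
  qed
  have "inj F"
  proof (subst linear_injective_0[OF \<open>linear F\<close>], intro allI impI)
    fix x assume "F x = 0"
    then have "norm (G (hyperplane_through x x x) x) = 0" using qF[of x] unfolding q_def by simp
    then show "x = 0" using nz hyperplane_through[OF dim4, of x x x] by fastforce
  qed
  have subF: "subspace (range F)"
    using \<open>linear F\<close> subspace_UNIV by (rule linear_subspace_image)
  \<comment> \<open>The codomain of \<open>F\<close> has one dimension too many; an isometry from
    the range of \<open>F\<close> onto the original space removes it without changing norms.\<close>
  have "dim (range F) = dim (UNIV :: 'a set)"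
    using \<open>linear F\<close> \<open>inj F\<close> by (intro dim_image_eq) auto
  then obtain i where i: "linear i" "i ` range F = (UNIV :: 'a set)" "\<And>x. x \<in> range F \<Longrightarrow> norm (i x) = norm x"
    using isometry_subspaces[OF subF subspace_UNIV] by metis
  have lin_iF: "linear (i \<circ> F)" using \<open>linear F\<close> i(1) by (rule linear_compose)
  have norm_iF: "norm ((i \<circ> F) x) = norm (F x)" for x using i(3) by simp
  have "surj (i \<circ> F)" using i(2) by (simp add: image_comp)
  then obtain f where f: "linear f" "(i \<circ> F) \<circ> f = id" "f \<circ> (i \<circ> F) = id"
    using lin_iF linear_surjective_isomorphism by (metis (no_types, lifting) comp_apply eq_id_iff ext)
  have "inj f" using f(2) by (metis inj_on_id inj_on_imageI2)
  moreover have "B = (\<lambda>x. f x + 0) ` cball 0 1"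
  proof (intro equalityI subsetI)
    fix x assume "x \<in> B"
    then have "(i \<circ> F) x \<in> cball 0 1" using B_iff norm_iF by (simp del: comp_apply)
    moreover have "x = f ((i \<circ> F) x)" using f(3) by (metis comp_apply id_apply)
    ultimately show "x \<in> (\<lambda>x. f x + 0) ` cball 0 1" by auto
  next
    fix x assume "x \<in> (\<lambda>x. f x + 0) ` cball 0 1"
    then obtain y where y: "norm y \<le> 1" "x = f y" by auto
    have "(i \<circ> F) x = y" using f(2) y(2) by (metis comp_apply id_apply)
    then show "x \<in> B" using y(1) B_iff norm_iF by metis
  qed
  ultimately show ?thesis unfolding is_ellipsoid_def using f(1) by blast
qed

end

section \<open>Central balls, intersections of hyperplanes, and the conflict between axes\<close>

text \<open>A ball around \<open>x\<close> moves to the origin, since \<open>y\<close> is the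
  midpoint of \<open>x + y\<close> and the reflection of \<open>x - y\<close>.\<close>

lemma symmetric_body_if_sym_convex_body:
  fixes B :: "'a::euclidean_space set"
  assumes "sym_convex_body_in UNIV B"
  shows "symmetric_body B"
proof -
  obtain x e where B: "compact B" "convex B" "\<forall>x\<in>B. - x \<in> B" and e: "0 < e" "ball x e \<subseteq> B"
    using assms unfolding sym_convex_body_in_def by auto
  have "y \<in> B" if "norm y < e" for y
  proof -
    have "x + y \<in> B" "x - y \<in> B"
      using that by (auto intro!: subsetD[OF e(2)] simp: dist_norm)
    then have "x + y \<in> B" "- (x - y) \<in> B"
      using B(3) by blast+
    then have "(1/2) *\<^sub>R (x + y) + (1/2) *\<^sub>R (- (x - y)) \<in> B"
      by (rule convexD[OF B(2)]) auto
    moreover have "(1/2) *\<^sub>R (x + y) + (1/2) *\<^sub>R (- (x - y)) = y"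
      using scaleR_half_double[of y] by (simp add: scaleR_add_right scaleR_diff_right)
    ultimately show ?thesis by simp
  qed
  then have "ball 0 e \<subseteq> B" by auto
  then show ?thesis using B e(1) by unfold_locales auto
qed

lemma dim_Int_linear_hyperplanes:
  fixes H H' :: "'a::euclidean_space set"
  assumes "linear_hyperplane H" "linear_hyperplane H'"
  shows "DIM('a) \<le> dim (H \<inter> H') + 2"
proof -
  have "dim {x + y |x y. x \<in> H \<and> y \<in> H'} + dim (H \<inter> H') = dim H + dim H'"
    using assms by (intro dim_sums_Int) (auto simp: linear_hyperplane_def)
  moreover have "dim {x + y |x y. x \<in> H \<and> y \<in> H'} \<le> DIM('a)"
    by (rule dim_subset_UNIV)
  ultimately show ?thesis using assms by (simp add: linear_hyperplane_def)
qed

theorem theorem2: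
  fixes B :: "'a::euclidean_space set"
  assumes "DIM('a) \<ge> 5"
    and "sym_convex_body_in UNIV B"
    and "\<forall>H. linear_hyperplane H \<longrightarrow> affine_sym_body_of_revolution_in H (H \<inter> B)"
    and "\<forall>H1 H2. linear_hyperplane H1 \<and> linear_hyperplane H2 \<longrightarrow>
           lin_equiv_in H1 (H1 \<inter> B) H2 (H2 \<inter> B)"
  shows "is_ellipsoid B"
proof -
  interpret symmetric_body B
    by (rule symmetric_body_if_sym_convex_body[OF assms(2)])
  have dim4: "4 \<le> DIM('a)" using assms(1) by simp
  have sub: "subspace H" "3 \<le> dim H" if "linear_hyperplane H" for H :: "'a set"
    using that assms(1) by (auto simp: linear_hyperplane_def)
  define H0 :: "'a set" where "H0 = hyperplane_through 0 0 0"
  have H0: "linear_hyperplane H0" using hyperplane_through[OF dim4] by (simp add: H0_def)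
  obtain \<eta> S p \<phi> where rep0: "revolution_rep H0 \<eta> S p \<phi>"
    using ex_revolution_rep[OF sub[OF H0]] assms(3) H0 by blast
  have reps: "\<exists>\<eta> S p. revolution_rep H \<eta> S p \<phi>" if H: "linear_hyperplane H" for H
  proof -
    obtain f where "linear f" "inj_on f H" "f ` H = H0" "f ` (H \<inter> B) = H0 \<inter> B"
      using assms(4) H H0 unfolding lin_equiv_in_def by blast
    then show ?thesis using revolution_rep_transport[OF rep0] sub(1)[OF H] by blast
  qed
  have "\<exists>\<kappa>. elliptic_profile \<phi> \<kappa>"
  proof (rule ccontr)
    assume no: "\<nexists>\<kappa>. elliptic_profile \<phi> \<kappa>"
    \<comment> \<open>In dimension at least 5 two hyperplanes meet in dimension at least 3, which
      the comparison of axes requires.\<close>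
    have par: "\<exists>c. p' = c *\<^sub>R p"
      if "linear_hyperplane H" "linear_hyperplane H'" "revolution_rep H \<eta> S p \<phi>"
        "revolution_rep H' \<eta>' S' p' \<phi>" "p \<in> H'" for H H' \<eta> S p \<eta>' S' p'
    proof -
      have "subspace (H \<inter> H')" "3 \<le> dim (H \<inter> H')" "p \<in> H \<inter> H'"
        using that sub dim_Int_linear_hyperplanes[OF that(1,2)] assms(1) revolution_repD(3)[OF that(3)]
        by (auto intro: subspace_inter)
      then show ?thesis
        using axes_parallel_or_elliptic[of "H \<inter> H'" H H' p] that(3,4) sub(1)[OF that(2)] no by blast
    qed
    \<comment> \<open>Chosen so that the axis \<open>p2\<close> of its section is orthogonal to
      \<open>p\<close>. A hyperplane containing both \<open>p\<close> and \<open>p2\<close> would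
      then need an axis parallel to each of them.\<close>
    define H2 where "H2 = {x. p \<bullet> x = 0}"
    have "p \<noteq> 0" using revolution_rep_nonzero[OF rep0] .
    then have H2: "linear_hyperplane H2"
      by (simp add: H2_def linear_hyperplane_def subspace_hyperplane dim_hyperplane)
    obtain \<eta>2 S2 p2 where rep2: "revolution_rep H2 \<eta>2 S2 p2 \<phi>" using reps[OF H2] by blast
    let ?H = "hyperplane_through p p2 p2"
    have H: "linear_hyperplane ?H" "p \<in> ?H" "p2 \<in> ?H" using hyperplane_through[OF dim4] by auto
    obtain \<eta>3 S3 p3 where rep3: "revolution_rep ?H \<eta>3 S3 p3 \<phi>" using reps[OF H(1)] by blast
    obtain c d where "p3 = c *\<^sub>R p" "p3 = d *\<^sub>R p2"
      using par[OF H0 H(1) rep0 rep3 H(2)] par[OF H2 H(1) rep2 rep3 H(3)] by blast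
    moreover have "p \<bullet> p2 = 0" using revolution_repD(3)[OF rep2] by (simp add: H2_def)
    ultimately have "c * (p \<bullet> p) = 0" by (metis inner_scaleR_right mult_zero_right)
    then have "p3 = 0" using \<open>p \<noteq> 0\<close> \<open>p3 = c *\<^sub>R p\<close> by simp
    then show False using revolution_rep_nonzero[OF rep3] by simp
  qed
  then obtain \<kappa> where "elliptic_profile \<phi> \<kappa>" by blast
  then show ?thesis
    using is_ellipsoid_if_quadratic_sections[OF dim4] quadratic_section_if_elliptic reps sub(1) by metis
qed

end
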